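(* Let $X$ be a Euclidean space, let $m,\ell$ be positive integers, $I:=\{1,\dots,m\}$, $J:=\{1,\dots,\ell\}$, and let $\{C_i\}_{i\in I}$ be closed subsets of $X$ with $C:=\bigcap_{i\in I}C_i\neq\varnothing$. For every $j\in J$ let $\lambda_j,\mu_j\in(0,2]$, $\widehat\beta_j:=\big(\frac{\lambda_j}{2-\lambda_j}+\frac{\mu_j}{2-\mu_j}\big)^{-1}$ (with $\widehat\beta_j:=0$ if $\lambda_j=2$ or $\mu_j=2$), $\alpha_j\in(0,1+\widehat\beta_j)$, and $s_j,t_j\in I$ with $s_j\neq t_j$, such that $\{s_j\}_{j\in J}\cup\{t_j\}_{j\in J}=I$. For $j\in J$ set $T_j:=(1-\alpha_j)\mathrm{Id}+\alpha_jP_{C_{t_j}}^{\mu_j}P_{C_{s_j}}^{\lambda_j}$. Let $w\in C$. Suppose that every $C_i$ ($i\in I$) is superregular at $w$, that $\{C_i\}_{i\in I}$ is linearly regular around $w$, and that for every $j\in J$ the pair $\{C_{s_j},C_{t_j}\}$ is linearly regular around $w$ if $\min\{\lambda_j,\mu_j\}<2$ and strongly regular at $w$ otherwise. Then the cyclic algorithm defined by $(T_j)_{j\in J}$ converges $R$-linearly locally (around $w$) to a point $\overline{x}\in C$.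
   Context: A Euclidean space is a finite-dimensional real inner product space; $\mathbb{N}=\{0,1,2,\dots\}$; $\mathbb{B}(w;\rho)$ is the closed ball with center $w$ and radius $\rho$. For nonempty $S\subseteq X$: $d_S(x)=\inf_{c\in S}\|x-c\|$, and $P_Sx=\{c\in S:\|x-c\|=d_S(x)\}$ is the (set-valued) projector. The relaxed projector is $P_S^\lambda:=(1-\lambda)\mathrm{Id}+\lambda P_S$ (set-valued). Set-valued operators are composed in the usual way: $T_jx=\{(1-\alpha_j)x+\alpha_js: s\in P_{C_{t_j}}^{\mu_j}r,\ r\in P_{C_{s_j}}^{\lambda_j}x\}$. A cyclic sequence generated by $(T_j)_{j\in J}$ is any sequence with $x_0\in X$ and $x_{n+1}\in T_{n+1}x_n$ for all $n\in\mathbb{N}$, where $T_{\ell n+j}:=T_j$ for $n\in\mathbb{N}$, $j\in J$. $R$-linear convergence of $(x_n)$ to $\overline{x}$ means that there are $\rho\in[0,1)$ and $\sigma\ge0$ with $\|x_n-\overline{x}\|\le\sigma\rho^n$ for all $n$. "Converges $R$-linearly locally to a point $\overline{x}\in C$" means: there is $r>0$ such that every cyclic sequence with $x_0\in\mathbb{B}(w;r)$ converges $R$-linearly to some point $\overline{x}\in C$ (depending on the sequence). A finite system $\{S_k\}_{k\in K}$ of closed sets is linearly regular around $w$ if there are $\delta,\kappa>0$ with $d_S(x)\le\kappa\max_{k\in K}d_{S_k}(x)$ for all $x\in\mathbb{B}(w;\delta)$, where $S:=\bigcap_{k\in K}S_k$. Proximal normal cone to $S$ at $x\in S$: $N^{\rm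 prox}_S(x)=\{\lambda(z-x): z\in X,\ x\in P_Sz,\ \lambda\ge0\}$. Limiting normal cone: $N_S(x)=\{u:\exists x_n\to x,\ u_n\to u,\ x_n\in S,\ u_n\in N_S^{\rm prox}(x_n)\}$. $S$ is superregular at $w$ if for every $\varepsilon>0$ there is $\delta>0$ such that $\langle u,x-y\rangle\ge-\varepsilon\|u\|\|x-y\|$ for all $x,y\in S\cap\mathbb{B}(w;\delta)$ and $u\in N^{\rm prox}_S(x)$. A pair $\{A,B\}$ with $w\in A\cap B$ is strongly regular at $w$ if $N_A(w)\cap(-N_B(w))=\{0\}$. *)

theory Defs
  imports "HOL-Analysis.Analysis"
begin

text \<open>
  The distance function of a nonempty set \<open>S\<close> is the library's \<^const>\<open>infdist\<close>;
  it is only applied to sets that contain the reference point \<open>w\<close> or a projection,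
  so its convention for the empty set plays no role.
\<close>

definition projector :: "'a::euclidean_space set \<Rightarrow> 'a \<Rightarrow> 'a set" where
  "projector S x = {c \<in> S. norm (x - c) = infdist x S}"

definition relaxed_projector :: "real \<Rightarrow> 'a::euclidean_space set \<Rightarrow> 'a \<Rightarrow> 'a set" where
  "relaxed_projector lam S x = {(1 - lam) *\<^sub>R x + lam *\<^sub>R p | p. p \<in> projector S x}"

text \<open>
  \<open>(1 - \<alpha>) Id + \<alpha> P\<^sub>B\<^sup>\<mu> P\<^sub>A\<^sup>\<lambda>\<close>: the projection onto \<open>A\<close> is performed first.
\<close>
definition gen_DR_operator ::
  "real \<Rightarrow> real \<Rightarrow> real \<Rightarrow> 'a::euclidean_space set \<Rightarrow> 'a set \<Rightarrow> 'a \<Rightarrow> 'a set" where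
  "gen_DR_operator \<alpha> lam \<mu> A B x =
     {(1 - \<alpha>) *\<^sub>R x + \<alpha> *\<^sub>R s | s r. r \<in> relaxed_projector lam A x \<and> s \<in> relaxed_projector \<mu> B r}"

definition beta_hat :: "real \<Rightarrow> real \<Rightarrow> real" where
  "beta_hat lam \<mu> =
     (if lam = 2 \<or> \<mu> = 2 then 0 else inverse (lam / (2 - lam) + \<mu> / (2 - \<mu>)))"

text \<open>
  The operators \<open>T 1, \<dots>, T l\<close> are extended by \<open>T (l * n + j) = T j\<close> for \<open>j \<in> {1..l}\<close>;
  hence the operator with index \<open>n + 1\<close> is \<open>T (n mod l + 1)\<close>.
\<close>
definition cyclic_sequence ::
  "nat \<Rightarrow> (nat \<Rightarrow> 'a::euclidean_space \<Rightarrow> 'a set) \<Rightarrow> (nat \<Rightarrow> 'a) \<Rightarrow> bool" where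
  "cyclic_sequence l T x \<longleftrightarrow> (\<forall>n. x (n + 1) \<in> T (n mod l + 1) (x n))"

definition R_linear_convergence :: "(nat \<Rightarrow> 'a::euclidean_space) \<Rightarrow> 'a \<Rightarrow> bool" where
  "R_linear_convergence x xbar \<longleftrightarrow>
     (\<exists>\<rho>::real. \<exists>\<sigma>::real. 0 \<le> \<rho> \<and> \<rho> < 1 \<and> 0 \<le> \<sigma> \<and> (\<forall>n. norm (x n - xbar) \<le> \<sigma> * \<rho> ^ n))"

text \<open>
  The radius \<open>r\<close> is uniform; the limit and the rate may depend on the sequence.
\<close>
definition cyclic_R_linear_locally ::
  "nat \<Rightarrow> (nat \<Rightarrow> 'a::euclidean_space \<Rightarrow> 'a set) \<Rightarrow> 'a set \<Rightarrow> 'a \<Rightarrow> bool" where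
  "cyclic_R_linear_locally l T S w \<longleftrightarrow>
     (\<exists>r>0. \<forall>x. cyclic_sequence l T x \<and> x 0 \<in> cball w r \<longrightarrow>
        (\<exists>xbar\<in>S. R_linear_convergence x xbar))"

text \<open>Meant for finite nonempty \<open>K\<close> (\<^const>\<open>Max\<close> is unspecified otherwise).\<close>
definition linearly_regular_around ::
  "('i \<Rightarrow> 'a::euclidean_space set) \<Rightarrow> 'i set \<Rightarrow> 'a \<Rightarrow> bool" where
  "linearly_regular_around S K w \<longleftrightarrow>
     (\<exists>\<delta>>0. \<exists>\<kappa>>0. \<forall>x\<in>cball w \<delta>.
        infdist x (\<Inter>k\<in>K. S k) \<le> \<kappa> * Max ((\<lambda>k. infdist x (S k)) ` K))"

definition prox_normal_cone :: "'a::euclidean_space set \<Rightarrow> 'a \<Rightarrow> 'a set" where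
  "prox_normal_cone S x = {lam *\<^sub>R (z - x) | lam z. x \<in> projector S z \<and> 0 \<le> lam}"

definition limiting_normal_cone :: "'a::euclidean_space set \<Rightarrow> 'a \<Rightarrow> 'a set" where
  "limiting_normal_cone S x =
     {u. \<exists>xs us. xs \<longlonglongrightarrow> x \<and> us \<longlonglongrightarrow> u \<and>
           (\<forall>n. xs n \<in> S \<and> us n \<in> prox_normal_cone S (xs n))}"

definition superregular_at :: "'a::euclidean_space set \<Rightarrow> 'a \<Rightarrow> bool" where
  "superregular_at S w \<longleftrightarrow>
     (\<forall>\<epsilon>>0. \<exists>\<delta>>0. \<forall>x \<in> S \<inter> cball w \<delta>. \<forall>y \<in> S \<inter> cball w \<delta>. \<forall>u \<in> prox_normal_cone S x.
        u \<bullet> (x - y) \<ge> - \<epsilon> * norm u * norm (x - y))"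

definition strongly_regular_at :: "'a::euclidean_space set \<Rightarrow> 'a set \<Rightarrow> 'a \<Rightarrow> bool" where
  "strongly_regular_at A B w \<longleftrightarrow>
     limiting_normal_cone A w \<inter> uminus ` limiting_normal_cone B w = {0}"

end

theory Submission
  imports Defs
begin

text \<open>
  Superregularity makes each \<open>T\<^sub>j\<close> quasi-Fejer near \<open>w\<close>: up to a factor \<open>1 + \<epsilon>\<close> on the old squared
  distance to any nearby \<open>y \<in> A \<inter> B\<close>, the new one drops by a fixed multiple of the squared step
  length. Each \<open>T\<^sub>j\<close> is moreover coercive, that is, the distances to its two sets are bounded by a
  multiple of the step length. If one of the relaxation parameters is less than \<open>2\<close>, this follows from
  linear regularity of the pair together with the Fejer inequality at the projection onto \<open>A \<inter> B\<close>; if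
  both equal \<open>2\<close>, from a compactness argument that bounds unit normals to \<open>A\<close> away from opposite normals
  to \<open>B\<close>. Over one cycle, the Fejer inequality at the projection of the starting point onto \<open>C\<close>,
  coercivity, and linear regularity of the whole system shrink the distance to \<open>C\<close> by a fixed factor,
  while the displacement is at most a multiple of that distance; hence the steps decay geometrically.
\<close>

section \<open>Projections and proximal normals\<close>

lemma projector_norm_le:
  assumes "p \<in> projector S x" "y \<in> S"
  shows "norm (x - p) \<le> norm (x - y)"
proof -
  have "norm (x - p) = infdist x S" using assms(1) by (simp add: projector_def)
  also have "\<dots> \<le> dist x y" using assms(2) by (rule infdist_le)
  finally show ?thesis by (simp add: dist_norm)
qed

lemma projector_nonempty:
  assumes "closed S" "S \<noteq> {}"
  obtains p where "p \<in> projector S x"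
proof -
  obtain p where "p \<in> S" "infdist x S = dist x p"
    using infdist_attains_inf[OF assms] by blast
  then show thesis using that by (simp add: projector_def dist_norm)
qed

lemma projector_imp_prox_normal:
  assumes "p \<in> projector S x"
  shows "x - p \<in> prox_normal_cone S p"
proof -
  have "x - p = 1 *\<^sub>R (x - p)" by simp
  moreover have "(0::real) \<le> 1" by simp
  ultimately show ?thesis unfolding prox_normal_cone_def using assms by blast
qed

lemma prox_normal_cone_scaleR:
  assumes "u \<in> prox_normal_cone S x" "0 \<le> c"
  shows "c *\<^sub>R u \<in> prox_normal_cone S x"
proof -
  obtain k z where "u = k *\<^sub>R (z - x)" "x \<in> projector S z" "0 \<le> k"
    using assms(1) unfolding prox_normal_cone_def by auto
  then show ?thesis
    unfolding prox_normal_cone_def using assms(2)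
    by (auto intro!: exI[of _ "c * k"] exI[of _ z])
qed

section \<open>Relaxation identities and quasi-Fejer inequalities\<close>

lemma norm_relaxed_sub:
  fixes x p :: "'a::real_normed_vector"
  assumes "0 \<le> k"
  shows "norm (x - ((1 - k) *\<^sub>R x + k *\<^sub>R p)) = k * norm (x - p)"
proof -
  have "x - ((1 - k) *\<^sub>R x + k *\<^sub>R p) = k *\<^sub>R (x - p)"
    by (simp add: algebra_simps)
  then show ?thesis using assms by simp
qed

lemma norm_affine_combination_diff_square:
  fixes x p y :: "'a::real_inner"
  shows "(norm ((1 - k) *\<^sub>R x + k *\<^sub>R p - y))\<^sup>2 =
    (1 - k) * (norm (x - y))\<^sup>2 + k * (norm (p - y))\<^sup>2 - k * (1 - k) * (norm (x - p))\<^sup>2"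
proof -
  define u v where "u = x - y" and "v = p - y"
  have eq: "(1 - k) *\<^sub>R x + k *\<^sub>R p - y = (1 - k) *\<^sub>R u + k *\<^sub>R v" "x - p = u - v"
    by (simp_all add: u_def v_def algebra_simps)
  have "((1 - k) *\<^sub>R u + k *\<^sub>R v) \<bullet> ((1 - k) *\<^sub>R u + k *\<^sub>R v) =
      (1 - k) * (u \<bullet> u) + k * (v \<bullet> v) - k * (1 - k) * ((u - v) \<bullet> (u - v))"
    by (simp add: inner_add_left inner_add_right inner_diff_left inner_diff_right
        inner_commute[of v u]) (simp add: algebra_simps)
  then show ?thesis by (simp only: eq power2_norm_eq_inner u_def[symmetric] v_def[symmetric])
qed

text \<open>Expanding around \<open>p\<close> isolates the inner product of \<open>x - p\<close>
  with \<open>p - y\<close>, the quantity that superregularity bounds from below; the preceding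
  identity serves the outer averaging with \<open>\<alpha>\<close> instead.\<close>

lemma norm_relaxed_diff_square:
  fixes x p y :: "'a::real_inner"
  shows "(norm ((1 - k) *\<^sub>R x + k *\<^sub>R p - y))\<^sup>2 =
    (norm (x - y))\<^sup>2 - 2 * k * ((x - p) \<bullet> (p - y)) - k * (2 - k) * (norm (x - p))\<^sup>2"
proof -
  define u v where "u = x - p" and "v = p - y"
  have eq: "(1 - k) *\<^sub>R x + k *\<^sub>R p - y = (1 - k) *\<^sub>R u + v" "x - y = u + v"
    by (simp_all add: u_def v_def algebra_simps)
  have "((1 - k) *\<^sub>R u + v) \<bullet> ((1 - k) *\<^sub>R u + v) =
      (u + v) \<bullet> (u + v) - 2 * k * (u \<bullet> v) - k * (2 - k) * (u \<bullet> u)"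
    by (simp add: inner_add_left inner_add_right inner_commute[of v u]) (simp add: algebra_simps)
  then show ?thesis by (simp only: eq power2_norm_eq_inner u_def[symmetric] v_def[symmetric])
qed

text \<open>The vector \<open>x - p\<close> is a proximal normal to \<open>S\<close> at
  \<open>p\<close>, so superregularity makes the cross term almost nonnegative; projecting gives
  \<open>norm (x - p) \<le> norm (x - y)\<close>, which turns the error into a multiple of
  \<open>(norm (x - y))\<^sup>2\<close>.\<close>

lemma superregular_relaxed_projector:
  fixes S :: "'a::euclidean_space set"
  assumes "superregular_at S w" "w \<in> S" "\<epsilon> > 0"
  obtains \<delta> where "\<delta> > 0"
    "\<And>x y p k. \<lbrakk>x \<in> cball w \<delta>; y \<in> S \<inter> cball w \<delta>; p \<in> projector S x; 0 < k; k \<le> 2\<rbrakk> \<Longrightarrow>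
      (norm ((1 - k) *\<^sub>R x + k *\<^sub>R p - y))\<^sup>2 \<le>
        (1 + \<epsilon>) * (norm (x - y))\<^sup>2 - k * (2 - k) * (norm (x - p))\<^sup>2"
proof -
  \<comment> \<open>The 8 is the product of 2, from
    \<open>norm (p - y) \<le> 2 * norm (x - y)\<close>, and 4, the largest value of the factor
    \<open>2 * k\<close>.\<close>
  have "\<epsilon> / 8 > 0" using assms(3) by simp
  from assms(1)[unfolded superregular_at_def, rule_format, OF this]
  obtain d where d: "d > 0"
    and reg: "\<And>x y u. \<lbrakk>x \<in> S \<inter> cball w d; y \<in> S \<inter> cball w d; u \<in> prox_normal_cone S x\<rbrakk>
      \<Longrightarrow> u \<bullet> (x - y) \<ge> - (\<epsilon> / 8) * norm u * norm (x - y)"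
    by blast
  \<comment> \<open>Half the radius suffices because \<open>p\<close> is at most twice as far from
    \<open>w\<close> as \<open>x\<close> is.\<close>
  show thesis
  proof (rule that[of "d / 2"])
    show "d / 2 > 0" using d by simp
    fix x y p k
    assume x: "x \<in> cball w (d / 2)" and y: "y \<in> S \<inter> cball w (d / 2)" and p: "p \<in> projector S x"
      and k: "0 < k" "k \<le> (2::real)"
    have pw: "norm (x - p) \<le> norm (x - w)" and py: "norm (x - p) \<le> norm (x - y)"
      using projector_norm_le[OF p] assms(2) y by auto
    have "dist w p \<le> dist w x + dist x p" by (rule dist_triangle)
    then have "p \<in> S \<inter> cball w d"
      using p x pw by (simp add: projector_def dist_norm norm_minus_commute)
    moreover have "y \<in> S \<inter> cball w d" using y d by auto
    ultimately have "(x - p) \<bullet> (p - y) \<ge> - (\<epsilon> / 8) * norm (x - p) * norm (p - y)"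
      using reg projector_imp_prox_normal[OF p] by blast
    moreover have "norm (x - p) * norm (p - y) \<le> norm (x - y) * (2 * norm (x - y))"
    proof (rule mult_mono[OF py])
      have "norm (p - y) \<le> norm (p - x) + norm (x - y)"
        using norm_triangle_ineq[of "p - x" "x - y"] by simp
      then show "norm (p - y) \<le> 2 * norm (x - y)"
        using py by (simp add: norm_minus_commute)
    qed auto
    then have "\<epsilon> / 8 * (norm (x - p) * norm (p - y)) \<le> \<epsilon> / 8 * (norm (x - y) * (2 * norm (x - y)))"
      using assms(3) by (intro mult_left_mono) auto
    ultimately have "(x - p) \<bullet> (p - y) \<ge> - (\<epsilon> / 4) * (norm (x - y))\<^sup>2"
      by (simp add: power2_eq_square algebra_simps)
    moreover have "k * (\<epsilon> / 4 * (norm (x - y))\<^sup>2) \<le> 2 * (\<epsilon> / 4 * (norm (x - y))\<^sup>2)"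
      using k assms(3) by (intro mult_right_mono) auto
    moreover have "k * (- (\<epsilon> / 4) * (norm (x - y))\<^sup>2) \<le> k * ((x - p) \<bullet> (p - y))"
      using calculation(1) k by (intro mult_left_mono) auto
    ultimately have "2 * k * ((x - p) \<bullet> (p - y)) \<ge> - \<epsilon> * (norm (x - y))\<^sup>2"
      by (simp add: algebra_simps)
    moreover have "(norm ((1 - k) *\<^sub>R x + k *\<^sub>R p - y))\<^sup>2 =
        (norm (x - y))\<^sup>2 - 2 * k * ((x - p) \<bullet> (p - y)) - k * (2 - k) * (norm (x - p))\<^sup>2"
      by (rule norm_relaxed_diff_square)
    ultimately show "(norm ((1 - k) *\<^sub>R x + k *\<^sub>R p - y))\<^sup>2 \<le>
        (1 + \<epsilon>) * (norm (x - y))\<^sup>2 - k * (2 - k) * (norm (x - p))\<^sup>2"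
      by (simp add: algebra_simps)
  qed
qed

text \<open>The estimate for one relaxed projection is chained, first onto \<open>A\<close> and then
  onto \<open>B\<close>, with \<open>y\<close> in both sets.\<close>

lemma superregular_double_relaxed_projector:
  fixes A B :: "'a::euclidean_space set"
  assumes reg: "superregular_at A w" "superregular_at B w" and w: "w \<in> A \<inter> B"
    and "0 < lam" "lam \<le> 2" "0 < \<mu>" "\<mu> \<le> 2" "\<epsilon> > 0"
  obtains \<delta> where "\<delta> > 0"
    "\<And>x y a r b s. \<lbrakk>x \<in> cball w \<delta>; y \<in> A \<inter> B \<inter> cball w \<delta>; a \<in> projector A x;
        r = (1 - lam) *\<^sub>R x + lam *\<^sub>R a; b \<in> projector B r; s = (1 - \<mu>) *\<^sub>R r + \<mu> *\<^sub>R b\<rbrakk> \<Longrightarrow>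
      (norm (s - y))\<^sup>2 \<le> (1 + \<epsilon>) * (norm (x - y))\<^sup>2
        - lam * (2 - lam) * (norm (x - a))\<^sup>2 - \<mu> * (2 - \<mu>) * (norm (r - b))\<^sup>2"
proof -
  \<comment> \<open>With \<open>e\<close> at most 1 and at most \<open>\<epsilon> / 3\<close>, two
    factors \<open>1 + e\<close> multiply to at most \<open>1 + \<epsilon>\<close>.\<close>
  define e where "e = min 1 (\<epsilon> / 3)"
  have e: "e > 0" "e \<le> 1" "3 * e \<le> \<epsilon>" using assms by (auto simp: e_def)
  have e2: "(1 + e) * (1 + e) \<le> 1 + \<epsilon>"
  proof -
    have "e * e \<le> e" using e by (intro mult_left_le) auto
    moreover have "(1 + e) * (1 + e) = 1 + 2 * e + e * e" by (simp add: algebra_simps)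
    ultimately show ?thesis using e(3) by linarith
  qed
  obtain d1 where d1: "d1 > 0" and f1: 
    "\<And>x y p k. \<lbrakk>x \<in> cball w d1; y \<in> A \<inter> cball w d1; p \<in> projector A x; 0 < k; k \<le> 2\<rbrakk> \<Longrightarrow>
      (norm ((1 - k) *\<^sub>R x + k *\<^sub>R p - y))\<^sup>2 \<le>
        (1 + e) * (norm (x - y))\<^sup>2 - k * (2 - k) * (norm (x - p))\<^sup>2"
    using superregular_relaxed_projector[OF reg(1) _ e(1)] w by blast
  obtain d2 where d2: "d2 > 0" and f2: 
    "\<And>x y p k. \<lbrakk>x \<in> cball w d2; y \<in> B \<inter> cball w d2; p \<in> projector B x; 0 < k; k \<le> 2\<rbrakk> \<Longrightarrow>
      (norm ((1 - k) *\<^sub>R x + k *\<^sub>R p - y))\<^sup>2 \<le>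
        (1 + e) * (norm (x - y))\<^sup>2 - k * (2 - k) * (norm (x - p))\<^sup>2"
    using superregular_relaxed_projector[OF reg(2) _ e(1)] w by blast
  \<comment> \<open>The intermediate point \<open>r\<close> may be three times as far from
    \<open>w\<close> as \<open>x\<close> is, hence the division of \<open>d2\<close> by 3.\<close>
  show thesis
  proof (rule that[of "min d1 (d2 / 3)"])
    show "min d1 (d2 / 3) > 0" using d1 d2 by simp
    fix x y a r b s
    assume x: "x \<in> cball w (min d1 (d2 / 3))" and y: "y \<in> A \<inter> B \<inter> cball w (min d1 (d2 / 3))"
      and a: "a \<in> projector A x" and r: "r = (1 - lam) *\<^sub>R x + lam *\<^sub>R a"
      and b: "b \<in> projector B r" and s: "s = (1 - \<mu>) *\<^sub>R r + \<mu> *\<^sub>R b"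
    have "norm (x - a) \<le> norm (x - w)" using projector_norm_le[OF a] w by auto
    then have "norm (x - r) \<le> 2 * norm (x - w)"
      using norm_relaxed_sub[of lam x a] mult_mono[of lam 2 "norm (x - a)" "norm (x - w)"] assms
      by (simp add: r)
    moreover have "dist w r \<le> dist w x + dist x r" by (rule dist_triangle)
    ultimately have "r \<in> cball w d2" using x by (simp add: dist_norm norm_minus_commute)
    then have 2: "(norm (s - y))\<^sup>2 \<le> (1 + e) * (norm (r - y))\<^sup>2 - \<mu> * (2 - \<mu>) * (norm (r - b))\<^sup>2"
      unfolding s using f2[of r y b \<mu>] y b d2 assms by auto
    have 1: "(norm (r - y))\<^sup>2 \<le> (1 + e) * (norm (x - y))\<^sup>2 - lam * (2 - lam) * (norm (x - a))\<^sup>2"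
      unfolding r using f1[of x y a lam] x y a assms by auto
    have "0 \<le> lam * (2 - lam) * (norm (x - a))\<^sup>2" using assms by simp
    with e(1) have "0 \<le> e * (lam * (2 - lam) * (norm (x - a))\<^sup>2)" by simp
    moreover have "(1 + e) * (norm (r - y))\<^sup>2 \<le>
        (1 + e) * ((1 + e) * (norm (x - y))\<^sup>2 - lam * (2 - lam) * (norm (x - a))\<^sup>2)"
      using 1 e by (intro mult_left_mono) auto
    moreover have "(1 + e) * (1 + e) * (norm (x - y))\<^sup>2 \<le> (1 + \<epsilon>) * (norm (x - y))\<^sup>2"
      using e2 by (intro mult_right_mono) auto
    ultimately show "(norm (s - y))\<^sup>2 \<le> (1 + \<epsilon>) * (norm (x - y))\<^sup>2
        - lam * (2 - lam) * (norm (x - a))\<^sup>2 - \<mu> * (2 - \<mu>) * (norm (r - b))\<^sup>2"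
      using 2 by (simp add: algebra_simps)
  qed
qed

text \<open>Cauchy-Schwarz with the weights \<open>lam / (2 - lam)\<close> and
  \<open>\<mu> / (2 - \<mu>)\<close>; \<open>beta_hat\<close> is the reciprocal of their sum. If a
  parameter equals 2, the left side vanishes.\<close>

lemma beta_hat_le:
  fixes u v :: "'a::real_inner"
  assumes "0 < lam" "lam \<le> 2" "0 < \<mu>" "\<mu> \<le> 2"
  shows "beta_hat lam \<mu> * (norm (lam *\<^sub>R u + \<mu> *\<^sub>R v))\<^sup>2 \<le>
    lam * (2 - lam) * (norm u)\<^sup>2 + \<mu> * (2 - \<mu>) * (norm v)\<^sup>2"
proof (cases "lam = 2 \<or> \<mu> = 2")
  case True
  then show ?thesis using assms by (auto simp: beta_hat_def)
next
  case False
  define c d where "c = 2 - lam" and "d = 2 - \<mu>"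
  have cd: "c > 0" "d > 0" using False assms by (auto simp: c_def d_def)
  have "(norm (lam *\<^sub>R u + \<mu> *\<^sub>R v))\<^sup>2 \<le> (lam * norm u + \<mu> * norm v)\<^sup>2"
    using norm_triangle_ineq[of "lam *\<^sub>R u" "\<mu> *\<^sub>R v"] assms by (intro power_mono) auto
  also have "\<dots> \<le> (lam / c + \<mu> / d) * (lam * c * (norm u)\<^sup>2 + \<mu> * d * (norm v)\<^sup>2)"
  proof -
    have "(lam / c + \<mu> / d) * (lam * c * (norm u)\<^sup>2 + \<mu> * d * (norm v)\<^sup>2)
        - (lam * norm u + \<mu> * norm v)\<^sup>2 = lam * \<mu> / (c * d) * (c * norm u - d * norm v)\<^sup>2"
      using cd by (simp add: field_simps power2_eq_square)
    also have "\<dots> \<ge> 0" using cd assms by simp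
    finally show ?thesis by simp
  qed
  finally have "(norm (lam *\<^sub>R u + \<mu> *\<^sub>R v))\<^sup>2 \<le>
      (lam / c + \<mu> / d) * (lam * c * (norm u)\<^sup>2 + \<mu> * d * (norm v)\<^sup>2)" .
  moreover have "lam / c + \<mu> / d > 0" using cd assms by (simp add: add_pos_pos)
  ultimately have "inverse (lam / c + \<mu> / d) * (norm (lam *\<^sub>R u + \<mu> *\<^sub>R v))\<^sup>2 \<le>
      lam * c * (norm u)\<^sup>2 + \<mu> * d * (norm v)\<^sup>2"
    by (simp add: inverse_eq_divide pos_divide_le_eq mult.commute)
  then show ?thesis using False by (simp add: beta_hat_def c_def d_def)
qed

text \<open>The last conclusion splits the step before averaging into a normal to \<open>A\<close>
  at \<open>a\<close> and a normal to \<open>B\<close> at \<open>b\<close>; both the Fejer and the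
  coercivity estimates rest on this splitting.\<close>

lemma gen_DR_operatorE:
  assumes "z \<in> gen_DR_operator \<alpha> lam \<mu> A B x"
  obtains a r b s where "a \<in> projector A x" "r = (1 - lam) *\<^sub>R x + lam *\<^sub>R a"
    "b \<in> projector B r" "s = (1 - \<mu>) *\<^sub>R r + \<mu> *\<^sub>R b" "z = (1 - \<alpha>) *\<^sub>R x + \<alpha> *\<^sub>R s"
    "x - s = lam *\<^sub>R (x - a) + \<mu> *\<^sub>R (r - b)"
proof -
  obtain a r b s where *: "a \<in> projector A x" "r = (1 - lam) *\<^sub>R x + lam *\<^sub>R a"
    "b \<in> projector B r" "s = (1 - \<mu>) *\<^sub>R r + \<mu> *\<^sub>R b" "z = (1 - \<alpha>) *\<^sub>R x + \<alpha> *\<^sub>R s"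
    using assms unfolding gen_DR_operator_def relaxed_projector_def by blast
  have "x - r = lam *\<^sub>R (x - a)" unfolding *(2) by (simp add: algebra_simps)
  moreover have "r - s = \<mu> *\<^sub>R (r - b)" unfolding *(4) by (simp add: algebra_simps)
  moreover have "x - s = (x - r) + (r - s)" by simp
  ultimately have "x - s = lam *\<^sub>R (x - a) + \<mu> *\<^sub>R (r - b)" by simp
  with * show thesis by (rule that)
qed

text \<open>\<open>beta_hat_le\<close> merges the two decrements into
  \<open>beta_hat lam \<mu> * (norm (x - s))\<^sup>2\<close>, and averaging contributes a further
  \<open>1 - \<alpha>\<close>. The upper bound on \<open>\<alpha>\<close> is exactly positivity of
  the resulting coefficient.\<close>

lemma gen_DR_operator_quasi_Fejer:
  fixes A B :: "'a::euclidean_space set"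
  assumes reg: "superregular_at A w" "superregular_at B w" "w \<in> A \<inter> B"
    and lm: "0 < lam" "lam \<le> 2" "0 < \<mu>" "\<mu> \<le> 2"
    and \<alpha>: "0 < \<alpha>" "\<alpha> < 1 + beta_hat lam \<mu>" and "\<epsilon> > 0"
  obtains \<delta> where "\<delta> > 0"
    "\<And>x y z. \<lbrakk>x \<in> cball w \<delta>; y \<in> A \<inter> B \<inter> cball w \<delta>; z \<in> gen_DR_operator \<alpha> lam \<mu> A B x\<rbrakk> \<Longrightarrow>
      (norm (z - y))\<^sup>2 \<le> (1 + \<epsilon>) * (norm (x - y))\<^sup>2
        - (1 + beta_hat lam \<mu> - \<alpha>) / \<alpha> * (norm (x - z))\<^sup>2"
proof -
  \<comment> \<open>Averaging scales the perturbation by \<open>\<alpha>\<close>, which this choice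
    compensates.\<close>
  have "\<epsilon> / \<alpha> > 0" using assms by simp
  then obtain d where d: "d > 0" and f:
    "\<And>x y a r b s. \<lbrakk>x \<in> cball w d; y \<in> A \<inter> B \<inter> cball w d; a \<in> projector A x;
        r = (1 - lam) *\<^sub>R x + lam *\<^sub>R a; b \<in> projector B r; s = (1 - \<mu>) *\<^sub>R r + \<mu> *\<^sub>R b\<rbrakk> \<Longrightarrow>
      (norm (s - y))\<^sup>2 \<le> (1 + \<epsilon> / \<alpha>) * (norm (x - y))\<^sup>2
        - lam * (2 - lam) * (norm (x - a))\<^sup>2 - \<mu> * (2 - \<mu>) * (norm (r - b))\<^sup>2"
    using superregular_double_relaxed_projector[OF reg lm] by blast
  show thesis
  proof (rule that[OF d])
    fix x y z
    assume x: "x \<in> cball w d" and y: "y \<in> A \<inter> B \<inter> cball w d"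
      and z_in: "z \<in> gen_DR_operator \<alpha> lam \<mu> A B x"
    from z_in obtain a r b s where *: "a \<in> projector A x" "r = (1 - lam) *\<^sub>R x + lam *\<^sub>R a"
      "b \<in> projector B r" "s = (1 - \<mu>) *\<^sub>R r + \<mu> *\<^sub>R b" and z: "z = (1 - \<alpha>) *\<^sub>R x + \<alpha> *\<^sub>R s"
      and xs: "x - s = lam *\<^sub>R (x - a) + \<mu> *\<^sub>R (r - b)"
      by (rule gen_DR_operatorE)
    have "(norm (s - y))\<^sup>2 \<le> (1 + \<epsilon> / \<alpha>) * (norm (x - y))\<^sup>2 - beta_hat lam \<mu> * (norm (x - s))\<^sup>2"
      using f[OF x y *] beta_hat_le[OF lm, of "x - a" "r - b"] unfolding xs by linarith
    then have "\<alpha> * (norm (s - y))\<^sup>2 \<le>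
        \<alpha> * ((1 + \<epsilon> / \<alpha>) * (norm (x - y))\<^sup>2 - beta_hat lam \<mu> * (norm (x - s))\<^sup>2)"
      using \<alpha> by (intro mult_left_mono) auto
    also have "\<dots> = (\<alpha> + \<epsilon>) * (norm (x - y))\<^sup>2 - \<alpha> * beta_hat lam \<mu> * (norm (x - s))\<^sup>2"
      using \<alpha> by (simp add: field_simps)
    finally have 1: "\<alpha> * (norm (s - y))\<^sup>2 \<le> \<dots>" .
    have 2: "(norm (z - y))\<^sup>2 =
        (1 - \<alpha>) * (norm (x - y))\<^sup>2 + \<alpha> * (norm (s - y))\<^sup>2 - \<alpha> * (1 - \<alpha>) * (norm (x - s))\<^sup>2"
      unfolding z by (rule norm_affine_combination_diff_square)
    have "norm (x - z) = \<alpha> * norm (x - s)" using norm_relaxed_sub[of \<alpha> x s] \<alpha> by (simp add: z)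
    then have 3: "(1 + beta_hat lam \<mu> - \<alpha>) / \<alpha> * (norm (x - z))\<^sup>2 =
        \<alpha> * (1 + beta_hat lam \<mu> - \<alpha>) * (norm (x - s))\<^sup>2"
      using \<alpha> by (simp add: power2_eq_square)
    show "(norm (z - y))\<^sup>2 \<le> (1 + \<epsilon>) * (norm (x - y))\<^sup>2
        - (1 + beta_hat lam \<mu> - \<alpha>) / \<alpha> * (norm (x - z))\<^sup>2"
      unfolding 2 3 using 1 by (simp add: algebra_simps)
  qed
qed

section \<open>Coercivity of a single step\<close>

lemma projector_norm_diff_le:
  assumes "p \<in> projector S x" "y \<in> S"
  shows "norm (p - y) \<le> 2 * norm (x - y)"
  using norm_triangle_ineq[of "p - x" "x - y"] projector_norm_le[OF assms]
  by (simp add: norm_minus_commute)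

lemma norm_relaxed_projector_diff_le:
  assumes "p \<in> projector S x" "y \<in> S" "0 < k" "k \<le> 2"
  shows "norm ((1 - k) *\<^sub>R x + k *\<^sub>R p - y) \<le> 3 * norm (x - y)"
proof -
  let ?r = "(1 - k) *\<^sub>R x + k *\<^sub>R p"
  have "norm (x - ?r) \<le> 2 * norm (x - y)"
    using projector_norm_le[OF assms(1,2)] assms(3,4) norm_relaxed_sub[of k x p]
      mult_mono[of k 2 "norm (x - p)" "norm (x - y)"] by simp
  then show ?thesis
    using norm_triangle_ineq[of "?r - x" "x - y"] by (simp add: norm_minus_commute)
qed

lemma infdist_le_double_projector:
  assumes "b \<in> projector B r"
  shows "infdist x B \<le> norm (x - r) + norm (r - b)"
  using infdist_triangle[of x B r] assms by (simp add: projector_def dist_norm)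

text \<open>Scalar core of the linearly regular case: \<open>D\<close> is the distance to the
  intersection, \<open>h\<close> the step length, \<open>p\<close> and \<open>q\<close> the two
  scaled projection displacements. As \<open>p\<close> and \<open>q\<close> differ by at most
  \<open>h\<close>, a quadratic bound on either one controls \<open>D\<close>: were \<open>h\<close>
  tiny compared with \<open>D\<close>, then \<open>D \<le> 4 * K * p\<close> would contradict that
  bound.\<close>

lemma quadratic_coercivity:
  fixes c K :: real
  assumes "c > 0" "K > 0"
  obtains \<nu> \<epsilon> where "\<nu> > 0" "\<epsilon> > 0"
    "\<And>D h p q. \<lbrakk>0 \<le> D; D \<le> K * (p + q); \<bar>p - q\<bar> \<le> h;
       c * p\<^sup>2 \<le> 2 * D * h + \<epsilon> * D\<^sup>2 \<or> c * q\<^sup>2 \<le> 2 * D * h + \<epsilon> * D\<^sup>2\<rbrakk> \<Longrightarrow> \<nu> * D \<le> h"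
proof -
  \<comment> \<open>The 64 is chosen so that the chain below ends in
    \<open>3 / 4 * (c * D\<^sup>2)\<close>, strictly less than \<open>c * D\<^sup>2\<close>.\<close>
  define \<epsilon> where "\<epsilon> = c / (64 * K\<^sup>2)"
  define \<nu> where "\<nu> = min (1 / (2 * K)) \<epsilon>"
  have pos: "\<epsilon> > 0" "\<nu> > 0" using assms by (auto simp: \<epsilon>_def \<nu>_def)
  have \<nu>: "\<nu> \<le> 1 / (2 * K)" "\<nu> \<le> \<epsilon>" by (auto simp: \<nu>_def)
  have eps: "64 * K\<^sup>2 * \<epsilon> = c" using assms by (simp add: \<epsilon>_def)
  \<comment> \<open>The larger sum \<open>2 * p + h\<close> makes the claim symmetric, so it applies
    with \<open>q\<close> in place of \<open>p\<close>. Since \<open>h\<close> may be negative here,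
    \<open>D = 0\<close> needs its own argument.\<close>
  have key: "\<nu> * D \<le> h"
    if D: "0 \<le> D" and le: "D \<le> K * (2 * p + h)" and quad: "c * p\<^sup>2 \<le> 2 * D * h + \<epsilon> * D\<^sup>2" for D h p
  proof (rule ccontr)
    assume "\<not> \<nu> * D \<le> h"
    then have h: "h < \<nu> * D" by simp
    have "D > 0"
    proof (rule ccontr)
      assume "\<not> D > 0"
      then have "D = 0" using D by simp
      then have "0 \<le> K * (2 * p + h)" "h < 0" "c * p\<^sup>2 \<le> 0" using le h quad by auto
      moreover from this(3) have "p = 0" using assms(1) by (simp add: mult_le_0_iff)
      ultimately show False using assms(2) by (simp add: zero_le_mult_iff)
    qed
    have "K * h \<le> K * (1 / (2 * K) * D)"
      using h \<nu>(1) D assms mult_right_mono[OF \<nu>(1) D] by (intro mult_left_mono) auto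
    then have "K * h \<le> D / 2" using assms by simp
    then have "D \<le> 4 * K * p" using le by (simp add: algebra_simps)
    then have "D\<^sup>2 \<le> (4 * K * p)\<^sup>2" using D by (intro power_mono) auto
    then have "c * D\<^sup>2 \<le> 16 * K\<^sup>2 * (c * p\<^sup>2)"
      using assms mult_left_mono[of "D\<^sup>2" "(4 * K * p)\<^sup>2" c] by (simp add: power_mult_distrib algebra_simps)
    also have "\<dots> \<le> 16 * K\<^sup>2 * (2 * D * h + \<epsilon> * D\<^sup>2)"
      using quad by (intro mult_left_mono) auto
    also have "\<dots> \<le> 16 * K\<^sup>2 * (3 * \<epsilon> * D\<^sup>2)"
    proof (rule mult_left_mono)
      have "h \<le> \<epsilon> * D" using h mult_right_mono[OF \<nu>(2) D] by linarith
      then have "2 * D * h \<le> 2 * D * (\<epsilon> * D)" using D by (intro mult_left_mono) auto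
      then show "2 * D * h + \<epsilon> * D\<^sup>2 \<le> 3 * \<epsilon> * D\<^sup>2"
        by (simp add: power2_eq_square algebra_simps)
    qed auto
    also have "\<dots> = 3 / 4 * ((64 * K\<^sup>2 * \<epsilon>) * D\<^sup>2)" by simp
    also have "\<dots> = 3 / 4 * (c * D\<^sup>2)" unfolding eps ..
    finally show False using \<open>D > 0\<close> assms by simp
  qed
  show thesis
  proof (rule that[OF pos(2,1)])
    fix D h p q
    assume *: "0 \<le> D" "D \<le> K * (p + q)" "\<bar>p - q\<bar> \<le> h"
      and "c * p\<^sup>2 \<le> 2 * D * h + \<epsilon> * D\<^sup>2 \<or> c * q\<^sup>2 \<le> 2 * D * h + \<epsilon> * D\<^sup>2"
    moreover have "K * (p + q) \<le> K * (2 * p + h)" "K * (p + q) \<le> K * (2 * q + h)"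
      using *(3) assms(2) by (auto intro!: mult_left_mono)
    ultimately show "\<nu> * D \<le> h" using key by (meson order_trans)
  qed
qed

text \<open>Let \<open>y\<close> be the projection of \<open>x\<close> onto
  \<open>A \<inter> B\<close>. As \<open>s\<close> is at least \<open>\<bar>D - h\<bar>\<close> away
  from \<open>y\<close>, the Fejer inequality leaves at most
  \<open>2 * D * h + \<epsilon> * D\<^sup>2\<close> for the decrements, while linear regularity
  bounds \<open>D\<close> by a multiple of \<open>p + q\<close>; \<open>quadratic_coercivity\<close>
  combines the two.\<close>

lemma gen_DR_operator_coercive_if_linearly_regular:
  fixes A B :: "'a::euclidean_space set"
  assumes "closed A" "closed B"
    and reg: "superregular_at A w" "superregular_at B w" and w: "w \<in> A \<inter> B"
    and lm: "0 < lam" "lam \<le> 2" "0 < \<mu>" "\<mu> \<le> 2" "min lam \<mu> < 2" and \<alpha>: "0 < \<alpha>"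
    and d: "d > 0" and \<kappa>: "\<kappa> > 0"
    and lin: "\<And>x. x \<in> cball w d \<Longrightarrow> infdist x (A \<inter> B) \<le> \<kappa> * max (infdist x A) (infdist x B)"
  obtains \<nu> \<delta> where "\<nu> > 0" "\<delta> > 0"
    "\<And>x z. \<lbrakk>x \<in> cball w \<delta>; z \<in> gen_DR_operator \<alpha> lam \<mu> A B x\<rbrakk> \<Longrightarrow>
      \<nu> * max (infdist x A) (infdist x B) \<le> norm (x - z)"
proof -
  \<comment> \<open>One of the two decrement coefficients may vanish; the maximum selects a positive
    one because some parameter is less than 2.\<close>
  define c where "c = max ((2 - lam) / lam) ((2 - \<mu>) / \<mu>)"
  \<comment> \<open>The bracket collects \<open>infdist x A = p / lam\<close> and
    \<open>infdist x B \<le> p + q / \<mu>\<close>.\<close>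
  define K where "K = \<kappa> * (1 + 1 / lam + 1 / \<mu>)"
  have c: "c > 0" using lm by (auto simp: c_def less_max_iff_disj min_less_iff_disj)
  have "1 + 1 / lam + 1 / \<mu> > 0" using lm by (intro add_pos_pos) auto
  then have K: "K > 0" unfolding K_def using \<kappa> by (rule mult_pos_pos[rotated])
  obtain \<nu> \<epsilon> where \<nu>: "\<nu> > 0" and \<epsilon>: "\<epsilon> > 0" and quad:
    "\<And>D h p q. \<lbrakk>0 \<le> D; D \<le> K * (p + q); \<bar>p - q\<bar> \<le> h;
       c * p\<^sup>2 \<le> 2 * D * h + \<epsilon> * D\<^sup>2 \<or> c * q\<^sup>2 \<le> 2 * D * h + \<epsilon> * D\<^sup>2\<rbrakk> \<Longrightarrow> \<nu> * D \<le> h"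
    using quadratic_coercivity[OF c K] by blast
  obtain d2 where d2: "d2 > 0" and f:
    "\<And>x y a r b s. \<lbrakk>x \<in> cball w d2; y \<in> A \<inter> B \<inter> cball w d2; a \<in> projector A x;
        r = (1 - lam) *\<^sub>R x + lam *\<^sub>R a; b \<in> projector B r; s = (1 - \<mu>) *\<^sub>R r + \<mu> *\<^sub>R b\<rbrakk> \<Longrightarrow>
      (norm (s - y))\<^sup>2 \<le> (1 + \<epsilon>) * (norm (x - y))\<^sup>2
        - lam * (2 - lam) * (norm (x - a))\<^sup>2 - \<mu> * (2 - \<mu>) * (norm (r - b))\<^sup>2"
    using superregular_double_relaxed_projector[OF reg w lm(1-4) \<epsilon>] by blast
  show thesis
  proof (rule that[of "\<alpha> * \<nu>" "min d (d2 / 2)"])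
    show "\<alpha> * \<nu> > 0" "min d (d2 / 2) > 0" using \<alpha> \<nu> d d2 by auto
    fix x z
    assume x: "x \<in> cball w (min d (d2 / 2))" and z_in: "z \<in> gen_DR_operator \<alpha> lam \<mu> A B x"
    from z_in obtain a r b s where a: "a \<in> projector A x" and r: "r = (1 - lam) *\<^sub>R x + lam *\<^sub>R a"
      and b: "b \<in> projector B r" and s: "s = (1 - \<mu>) *\<^sub>R r + \<mu> *\<^sub>R b"
      and z: "z = (1 - \<alpha>) *\<^sub>R x + \<alpha> *\<^sub>R s" and xs: "x - s = lam *\<^sub>R (x - a) + \<mu> *\<^sub>R (r - b)"
      by (rule gen_DR_operatorE)
    have "closed (A \<inter> B)" "A \<inter> B \<noteq> {}" using assms by auto
    then obtain y where y: "y \<in> projector (A \<inter> B) x" by (rule projector_nonempty)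
    have yAB: "y \<in> A \<inter> B" using y by (simp add: projector_def)
    have yw: "y \<in> cball w d2"
      using projector_norm_diff_le[OF y w] x by (simp add: dist_norm norm_minus_commute)
    define D h p q where "D = norm (x - y)" and "h = norm (x - s)"
      and "p = lam * norm (x - a)" and "q = \<mu> * norm (r - b)"
    have D: "D = infdist x (A \<inter> B)" using y by (simp add: projector_def D_def)
    have pq0: "p \<ge> 0" "q \<ge> 0" using lm by (auto simp: p_def q_def)
    have dA: "infdist x A = 1 / lam * p" using a lm by (simp add: projector_def p_def)
    have dB: "infdist x B \<le> p + 1 / \<mu> * q"
      using infdist_le_double_projector[OF b, of x] norm_relaxed_sub[of lam x a] lm
      by (simp add: r p_def q_def)
    have "max (infdist x A) (infdist x B) \<le> (1 + 1 / lam + 1 / \<mu>) * (p + q)"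
    proof -
      have "0 \<le> 1 / lam * p" "0 \<le> 1 / lam * q" "0 \<le> 1 / \<mu> * p" "0 \<le> 1 / \<mu> * q"
        using pq0 lm by auto
      moreover have "(1 + 1 / lam + 1 / \<mu>) * (p + q) =
          p + q + 1 / lam * p + 1 / lam * q + 1 / \<mu> * p + 1 / \<mu> * q"
        by (simp only: distrib_left distrib_right mult_1)
      ultimately show ?thesis using dA dB pq0 by linarith
    qed
    then have "\<kappa> * max (infdist x A) (infdist x B) \<le> \<kappa> * ((1 + 1 / lam + 1 / \<mu>) * (p + q))"
      using \<kappa> by (intro mult_left_mono) auto
    moreover have "x \<in> cball w d" using x by auto
    ultimately have "D \<le> K * (p + q)"
      unfolding D K_def mult.assoc using lin order_trans by blast
    \<comment> \<open>Reverse triangle inequality for the two normals whose sum is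
      \<open>x - s\<close>.\<close>
    moreover have "\<bar>p - q\<bar> \<le> h"
      using norm_triangle_ineq3[of "lam *\<^sub>R (x - a)" "- (\<mu> *\<^sub>R (r - b))"] lm
      by (simp add: h_def xs p_def q_def)
    moreover have "c * p\<^sup>2 \<le> 2 * D * h + \<epsilon> * D\<^sup>2 \<or> c * q\<^sup>2 \<le> 2 * D * h + \<epsilon> * D\<^sup>2"
    proof -
      have "\<bar>D - h\<bar> \<le> norm (s - y)"
        using norm_triangle_ineq3[of "x - y" "x - s"] by (simp add: D_def h_def)
      then have "(D - h)\<^sup>2 \<le> (norm (s - y))\<^sup>2" by (metis abs_le_square_iff abs_norm_cancel)
      moreover have "(norm (s - y))\<^sup>2 \<le> (1 + \<epsilon>) * D\<^sup>2 - (2 - lam) / lam * p\<^sup>2 - (2 - \<mu>) / \<mu> * q\<^sup>2"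
      proof -
        have "(2 - lam) / lam * p\<^sup>2 = lam * (2 - lam) * (norm (x - a))\<^sup>2"
          "(2 - \<mu>) / \<mu> * q\<^sup>2 = \<mu> * (2 - \<mu>) * (norm (r - b))\<^sup>2"
          using lm by (auto simp: p_def q_def power_mult_distrib power2_eq_square)
        moreover have "x \<in> cball w d2" using x d2 by auto
        ultimately show ?thesis using f[OF _ _ a r b s, of y] yAB yw by (simp add: D_def)
      qed
      moreover have "0 \<le> (2 - lam) / lam * p\<^sup>2" "0 \<le> (2 - \<mu>) / \<mu> * q\<^sup>2" using lm by auto
      moreover have "(D - h)\<^sup>2 = D\<^sup>2 - 2 * D * h + h\<^sup>2" by (simp add: power2_diff)
      moreover have "(1 + \<epsilon>) * D\<^sup>2 = D\<^sup>2 + \<epsilon> * D\<^sup>2" by (simp add: algebra_simps)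
      moreover have "0 \<le> h\<^sup>2" by simp
      ultimately have "(2 - lam) / lam * p\<^sup>2 \<le> 2 * D * h + \<epsilon> * D\<^sup>2"
        "(2 - \<mu>) / \<mu> * q\<^sup>2 \<le> 2 * D * h + \<epsilon> * D\<^sup>2" by linarith+
      moreover have "c = (2 - lam) / lam \<or> c = (2 - \<mu>) / \<mu>" unfolding c_def max_def by simp
      ultimately show ?thesis by metis
    qed
    ultimately have "\<nu> * D \<le> h" using quad[of D p q h] by (simp add: D_def)
    moreover have "max (infdist x A) (infdist x B) \<le> D"
      using infdist_le[of y A x] infdist_le[of y B x] yAB by (simp add: D_def dist_norm)
    ultimately have "\<nu> * max (infdist x A) (infdist x B) \<le> h"
      using \<nu> mult_left_mono[of "max (infdist x A) (infdist x B)" D \<nu>] by linarith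
    then have "\<alpha> * (\<nu> * max (infdist x A) (infdist x B)) \<le> \<alpha> * h"
      using \<alpha> by (intro mult_left_mono) auto
    then show "\<alpha> * \<nu> * max (infdist x A) (infdist x B) \<le> norm (x - z)"
      using norm_relaxed_sub[of \<alpha> x s] \<alpha> by (simp add: z h_def mult.assoc)
  qed
qed

text \<open>Otherwise there are base points tending to \<open>w\<close> and normals that nearly
  cancel. Normalised, they have a subsequence converging to a unit vector \<open>k\<close> and to
  \<open>- k\<close>, which are limiting normals at \<open>w\<close>, against strong
  regularity.\<close>

lemma strongly_regular_prox_normal_bound:
  fixes A B :: "'a::euclidean_space set"
  assumes "strongly_regular_at A B w"
  obtains \<nu> \<delta> where "\<nu> > 0" "\<delta> > 0"
    "\<And>a b u v. \<lbrakk>a \<in> A \<inter> cball w \<delta>; b \<in> B \<inter> cball w \<delta>; u \<in> prox_normal_cone A a;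
       v \<in> prox_normal_cone B b\<rbrakk> \<Longrightarrow> \<nu> * norm u \<le> norm (u + v)"
proof (rule ccontr)
  assume "\<not> thesis"
  \<comment> \<open>The same number serves as trial constant and trial radius.\<close>
  have "\<exists>a b u v. a \<in> A \<inter> cball w (inverse (real (Suc n))) \<and> b \<in> B \<inter> cball w (inverse (real (Suc n))) \<and>
      u \<in> prox_normal_cone A a \<and> v \<in> prox_normal_cone B b \<and>
      norm (u + v) < inverse (real (Suc n)) * norm u" for n
  proof (rule ccontr)
    assume *: "\<not> ?thesis"
    have "inverse (real (Suc n)) > 0" by simp
    from that[OF this this] * have thesis by (meson not_le)
    with \<open>\<not> thesis\<close> show False ..
  qed
  then obtain a b u v where
    a: "\<And>n. a n \<in> A \<inter> cball w (inverse (real (Suc n)))" and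
    b: "\<And>n. b n \<in> B \<inter> cball w (inverse (real (Suc n)))" and
    u: "\<And>n. u n \<in> prox_normal_cone A (a n)" and
    v: "\<And>n. v n \<in> prox_normal_cone B (b n)" and
    uv: "\<And>n. norm (u n + v n) < inverse (real (Suc n)) * norm (u n)" by metis
  \<comment> \<open>Both are divided by the norm of \<open>u n\<close>, so that
    \<open>U n + V n\<close> tends to zero and no separate bound on \<open>v n\<close> is required.
    The strict inequality \<open>uv\<close> rules out \<open>u n = 0\<close>.\<close>
  define U V where "U = (\<lambda>n. inverse (norm (u n)) *\<^sub>R u n)" and "V = (\<lambda>n. inverse (norm (u n)) *\<^sub>R v n)"
  have u0: "norm (u n) > 0" for n
  proof (rule ccontr)
    assume "\<not> norm (u n) > 0"
    then have "norm (u n) = 0" by simp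
    with uv[of n] show False by (simp add: not_less)
  qed
  have "U n \<in> sphere 0 1" for n using u0[of n] by (simp add: U_def)
  then obtain k f where k: "k \<in> sphere 0 1" and f: "strict_mono f" and Uk: "(U \<circ> f) \<longlonglongrightarrow> k"
    using compact_sphere[of "0::'a" 1] unfolding compact_def by blast
  have UV: "(\<lambda>n. U n + V n) \<longlonglongrightarrow> 0"
  proof (rule Lim_null_comparison[OF _ LIMSEQ_inverse_real_of_nat])
    have "norm (U n + V n) \<le> inverse (real (Suc n))" for n
    proof -
      have "norm (U n + V n) = inverse (norm (u n)) * norm (u n + v n)"
        unfolding U_def V_def by (simp flip: scaleR_add_right)
      also have "\<dots> \<le> inverse (norm (u n)) * (inverse (real (Suc n)) * norm (u n))"
        using uv[of n] by (intro mult_left_mono) auto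
      also have "\<dots> = inverse (real (Suc n))" using u0[of n] by simp
      finally show ?thesis .
    qed
    then show "\<forall>\<^sub>F n in sequentially. norm (U n + V n) \<le> inverse (real (Suc n))" by simp
  qed
  have "((\<lambda>n. U n + V n) \<circ> f) \<longlonglongrightarrow> 0" by (rule LIMSEQ_subseq_LIMSEQ[OF UV f])
  from tendsto_diff[OF this Uk] have Vk: "(V \<circ> f) \<longlonglongrightarrow> - k" by (simp add: o_def)
  have "c \<longlonglongrightarrow> w" if "\<And>n. c n \<in> cball w (inverse (real (Suc n)))" for c
  proof -
    have "(\<lambda>n. c n - w) \<longlonglongrightarrow> 0"
      by (rule Lim_null_comparison[OF _ LIMSEQ_inverse_real_of_nat])
        (use that in \<open>simp add: dist_norm norm_minus_commute\<close>)
    then show ?thesis by (simp add: LIM_zero_iff)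
  qed
  then have "(a \<circ> f) \<longlonglongrightarrow> w" "(b \<circ> f) \<longlonglongrightarrow> w"
    using a b f by (auto intro!: LIMSEQ_subseq_LIMSEQ)
  moreover have "U n \<in> prox_normal_cone A (a n)" "V n \<in> prox_normal_cone B (b n)" for n
    unfolding U_def V_def using u v by (auto intro!: prox_normal_cone_scaleR)
  moreover have "\<forall>n. (a \<circ> f) n \<in> A \<and> (U \<circ> f) n \<in> prox_normal_cone A ((a \<circ> f) n)"
    "\<forall>n. (b \<circ> f) n \<in> B \<and> (V \<circ> f) n \<in> prox_normal_cone B ((b \<circ> f) n)"
    using a b calculation(3,4) by auto
  ultimately have "k \<in> limiting_normal_cone A w" "- k \<in> limiting_normal_cone B w"
    unfolding limiting_normal_cone_def using Uk Vk by blast+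
  moreover from this(2) have "k \<in> uminus ` limiting_normal_cone B w"
    by (metis image_eqI minus_minus)
  ultimately have "k \<in> {0}" using assms unfolding strongly_regular_at_def by blast
  with k show False by simp
qed

text \<open>The step \<open>x - s\<close> is the sum of a normal to \<open>A\<close> and a normal to
  \<open>B\<close>, which cannot nearly cancel. It therefore dominates the first normal, hence also
  the second, and these two control both distances.\<close>

lemma gen_DR_operator_coercive_if_strongly_regular:
  fixes A B :: "'a::euclidean_space set"
  assumes w: "w \<in> A \<inter> B" and "strongly_regular_at A B w"
    and lm: "0 < lam" "lam \<le> 2" "0 < \<mu>" "\<mu> \<le> 2" and \<alpha>: "0 < \<alpha>"
  obtains \<nu> \<delta> where "\<nu> > 0" "\<delta> > 0"
    "\<And>x z. \<lbrakk>x \<in> cball w \<delta>; z \<in> gen_DR_operator \<alpha> lam \<mu> A B x\<rbrakk> \<Longrightarrow>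
      \<nu> * max (infdist x A) (infdist x B) \<le> norm (x - z)"
proof -
  obtain \<nu> d where \<nu>: "\<nu> > 0" and d: "d > 0" and bound:
    "\<And>a b u v. \<lbrakk>a \<in> A \<inter> cball w d; b \<in> B \<inter> cball w d; u \<in> prox_normal_cone A a;
       v \<in> prox_normal_cone B b\<rbrakk> \<Longrightarrow> \<nu> * norm u \<le> norm (u + v)"
    using strongly_regular_prox_normal_bound[OF assms(2)] by blast
  define M where "M = 1 / \<mu> + (1 + 1 / lam + 1 / \<mu>) * (1 / \<nu>)"
  have M: "M > 0" unfolding M_def using lm \<nu> by (intro add_pos_pos mult_pos_pos) auto
  \<comment> \<open>The 6 arises since \<open>r\<close> is at most 3 times as far from
    \<open>w\<close> as \<open>x\<close>, and \<open>b\<close> at most twice as far as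
    \<open>r\<close>.\<close>
  show thesis
  proof (rule that[of "\<alpha> / M" "d / 6"])
    show "\<alpha> / M > 0" "d / 6 > 0" using \<alpha> M d by auto
    fix x z
    assume x: "x \<in> cball w (d / 6)" and z_in: "z \<in> gen_DR_operator \<alpha> lam \<mu> A B x"
    from z_in obtain a r b s where a: "a \<in> projector A x" and r: "r = (1 - lam) *\<^sub>R x + lam *\<^sub>R a"
      and b: "b \<in> projector B r" and s: "s = (1 - \<mu>) *\<^sub>R r + \<mu> *\<^sub>R b"
      and z: "z = (1 - \<alpha>) *\<^sub>R x + \<alpha> *\<^sub>R s" and xs: "x - s = lam *\<^sub>R (x - a) + \<mu> *\<^sub>R (r - b)"
      by (rule gen_DR_operatorE)
    have wA: "w \<in> A" and wB: "w \<in> B" using w by auto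
    have "norm (r - w) \<le> 3 * norm (x - w)"
      unfolding r using norm_relaxed_projector_diff_le[OF a wA lm(1,2)] .
    moreover have "norm (a - w) \<le> 2 * norm (x - w)" "norm (b - w) \<le> 2 * norm (r - w)"
      using projector_norm_diff_le[OF a wA] projector_norm_diff_le[OF b wB] .
    moreover have "norm (x - w) \<le> d / 6" using x by (simp add: dist_norm norm_minus_commute)
    ultimately have ab: "a \<in> A \<inter> cball w d" "b \<in> B \<inter> cball w d"
      using a b d by (auto simp: projector_def dist_norm norm_minus_commute)
    define u v where "u = lam *\<^sub>R (x - a)" and "v = \<mu> *\<^sub>R (r - b)"
    have "u \<in> prox_normal_cone A a" "v \<in> prox_normal_cone B b"
      unfolding u_def v_def using a b lm by (auto intro!: prox_normal_cone_scaleR projector_imp_prox_normal)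
    then have "\<nu> * norm u \<le> norm (u + v)" by (rule bound[OF ab])
    then have "\<nu> * norm u \<le> norm (x - s)" by (simp add: xs u_def v_def)
    then have nu: "norm u \<le> 1 / \<nu> * norm (x - s)" using \<nu> by (simp add: field_simps)
    have nv: "norm v \<le> norm (x - s) + norm u"
      using norm_triangle_ineq4[of "x - s" u] by (simp add: xs u_def v_def)
    have dA: "infdist x A = 1 / lam * norm u" using a lm by (simp add: projector_def u_def)
    have dB: "infdist x B \<le> norm u + 1 / \<mu> * norm v"
      using infdist_le_double_projector[OF b, of x] norm_relaxed_sub[of lam x a] lm
      by (simp add: r u_def v_def)
    have "1 / \<mu> * norm v \<le> 1 / \<mu> * norm (x - s) + 1 / \<mu> * norm u"
      using nv mult_left_mono[of "norm v" "norm (x - s) + norm u" "1 / \<mu>"] lm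
      by (simp only: distrib_left) simp
    moreover have "0 \<le> 1 / lam * norm u" "0 \<le> 1 / \<mu> * norm u" "0 \<le> 1 / \<mu> * norm (x - s)"
      using lm by auto
    moreover have "(1 + 1 / lam + 1 / \<mu>) * norm u = norm u + 1 / lam * norm u + 1 / \<mu> * norm u"
      by (simp only: distrib_right mult_1)
    ultimately have "max (infdist x A) (infdist x B)
        \<le> 1 / \<mu> * norm (x - s) + (1 + 1 / lam + 1 / \<mu>) * norm u"
      using dA dB norm_ge_zero[of u] by linarith
    also have "\<dots> \<le> 1 / \<mu> * norm (x - s) + (1 + 1 / lam + 1 / \<mu>) * (1 / \<nu> * norm (x - s))"
      using nu lm by (intro add_left_mono mult_left_mono) auto
    also have "\<dots> = M * norm (x - s)" by (simp only: M_def distrib_right mult.assoc)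
    finally have "\<alpha> / M * max (infdist x A) (infdist x B) \<le> \<alpha> / M * (M * norm (x - s))"
      using \<alpha> M by (intro mult_left_mono) auto
    also have "\<dots> = norm (x - z)" using norm_relaxed_sub[of \<alpha> x s] \<alpha> M by (simp add: z)
    finally show "\<alpha> / M * max (infdist x A) (infdist x B) \<le> norm (x - z)" .
  qed
qed

section \<open>Contraction over a cycle and R-linear convergence\<close>

lemma geometric_steps_converge:
  fixes x :: "nat \<Rightarrow> 'a::euclidean_space"
  assumes step: "\<And>n. norm (x (n + 1) - x n) \<le> c * q ^ n" and q: "0 \<le> q" "q < 1"
  obtains z where "x \<longlonglongrightarrow> z" "R_linear_convergence x z"
proof -
  define c' where "c' = c / (1 - q)"
  have "0 \<le> c" using order_trans[OF norm_ge_zero step[of 0]] by simp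
  then have c': "0 \<le> c'" using q by (simp add: c'_def)
  have "c = c' * (1 - q)" using q by (simp add: c'_def)
  then have c: "c = c' - c' * q" by (simp add: algebra_simps)
  \<comment> \<open>Keeping the exact tail of the geometric sum lets the induction telescope through
    \<open>c = c' - c' * q\<close>.\<close>
  have le: "norm (x (n + k) - x n) \<le> c' * q ^ n - c' * q ^ (n + k)" for n k
  proof (induction k)
    case (Suc k)
    have "norm (x (n + Suc k) - x n) \<le> norm (x (n + k + 1) - x (n + k)) + norm (x (n + k) - x n)"
      using norm_triangle_ineq[of "x (n + k + 1) - x (n + k)" "x (n + k) - x n"] by simp
    also have "\<dots> \<le> c * q ^ (n + k) + (c' * q ^ n - c' * q ^ (n + k))"
      using step Suc by (intro add_mono)
    also have "\<dots> = c' * q ^ n - c' * q ^ (n + Suc k)" by (simp add: c algebra_simps)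
    finally show ?case .
  qed simp
  have le': "norm (x m - x n) \<le> c' * q ^ n" if "m \<ge> n" for m n
  proof -
    have "0 \<le> c' * q ^ m" using c' q by simp
    then show ?thesis using le[of n "m - n"] that by simp
  qed
  have lim0: "(\<lambda>n. c' * q ^ n) \<longlonglongrightarrow> 0"
    using tendsto_mult_right_zero[OF LIMSEQ_power_zero[of q], of c'] q by simp
  have "Cauchy x"
  proof (rule metric_CauchyI)
    fix e :: real assume "e > 0"
    then obtain N where N: "c' * q ^ N < e / 2"
      using order_tendstoD(2)[OF lim0, of "e / 2"] by (auto simp: eventually_sequentially)
    have "dist (x m) (x n) < e" if "m \<ge> N" "n \<ge> N" for m n
      using dist_triangle2[of "x m" "x n" "x N"] le'[OF that(1)] le'[OF that(2)] N
      by (simp add: dist_norm)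
    then show "\<exists>M. \<forall>m\<ge>M. \<forall>n\<ge>M. dist (x m) (x n) < e" by blast
  qed
  then obtain z where z: "x \<longlonglongrightarrow> z" using Cauchy_convergent convergent_def by blast
  have "norm (x n - z) \<le> c' * q ^ n" for n
  proof (rule LIMSEQ_le_const2)
    show "(\<lambda>m. norm (x n - x m)) \<longlonglongrightarrow> norm (x n - z)" by (intro tendsto_intros z)
    show "\<exists>N. \<forall>m\<ge>N. norm (x n - x m) \<le> c' * q ^ n"
      using le'[of n] norm_minus_commute[of "x n"] by metis
  qed
  with z q c' show thesis by (intro that) (auto simp: R_linear_convergence_def)
qed

lemma finite_uniform_pos:
  fixes P :: "'i \<Rightarrow> real \<Rightarrow> bool"
  assumes "finite J" "\<And>j. j \<in> J \<Longrightarrow> \<exists>d>0. P j d"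
    and "\<And>j d d'. \<lbrakk>P j d; 0 < d'; d' \<le> d\<rbrakk> \<Longrightarrow> P j d'"
  obtains d where "d > 0" "\<And>j. j \<in> J \<Longrightarrow> P j d"
proof -
  obtain f where f: "\<And>j. j \<in> J \<Longrightarrow> f j > 0 \<and> P j (f j)" using assms(2) by metis
  \<comment> \<open>The inserted 1 keeps the minimum well defined for empty
    \<open>J\<close>.\<close>
  define d where "d = Min (insert 1 (f ` J))"
  have "d > 0" using f assms(1) by (auto simp: d_def)
  moreover have "d \<le> f j" if "j \<in> J" for j using that assms(1) by (auto simp: d_def)
  ultimately show thesis using f assms(3) that by blast
qed

text \<open>Accumulating the Fejer inequality at the projection \<open>y\<close> of
  \<open>x 0\<close> bounds the sum of squared steps and confines the cycle to the ball. Regularity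
  selects a set whose distance controls \<open>D\<close>; coercivity at a step treating that set
  bounds \<open>D\<close> by the total step length, so the squared steps consume a fixed share of
  \<open>D\<^sup>2\<close>.\<close>

lemma quasi_Fejer_cycle:
  fixes x :: "nat \<Rightarrow> 'a::euclidean_space" and C :: "'i \<Rightarrow> 'a set"
  assumes S: "closed S" "w \<in> S"
    and pos: "0 < \<epsilon>" "(1 + \<epsilon>) ^ l \<le> 4" "0 < \<beta>" "0 < \<nu>" "0 < \<kappa>"
    and fejer: "\<And>n y. \<lbrakk>n < l; x n \<in> cball w \<delta>; y \<in> S \<inter> cball w \<delta>\<rbrakk> \<Longrightarrow>
      (norm (x (n + 1) - y))\<^sup>2 \<le> (1 + \<epsilon>) * (norm (x n - y))\<^sup>2 - \<beta> * (norm (x n - x (n + 1)))\<^sup>2"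
    and coercive: "\<And>n i. \<lbrakk>n < l; x n \<in> cball w \<delta>; i \<in> I n\<rbrakk> \<Longrightarrow>
      \<nu> * infdist (x n) (C i) \<le> norm (x n - x (n + 1))"
    and cover: "K \<subseteq> (\<Union>n<l. I n)"
    and regular: "\<exists>i\<in>K. infdist (x 0) S \<le> \<kappa> * infdist (x 0) (C i)"
    and x0: "4 * norm (x 0 - w) \<le> \<delta>"
  shows "n \<le> l \<Longrightarrow> norm (x n - x 0) \<le> 3 * infdist (x 0) S"
    and "(infdist (x l) S)\<^sup>2 \<le>
      ((1 + \<epsilon>) ^ l - \<beta> / (l * (\<kappa> * (1 + 1 / \<nu>))\<^sup>2)) * (infdist (x 0) S)\<^sup>2"
proof -
  define D where "D = infdist (x 0) S"
  obtain y where y: "y \<in> projector S (x 0)" using projector_nonempty[OF S(1)] S(2) by blast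
  have yS: "y \<in> S" and Dy: "norm (x 0 - y) = D" using y by (auto simp: projector_def D_def)
  have Dw: "D \<le> norm (x 0 - w)" using projector_norm_le[OF y S(2)] Dy by simp
  have D0: "0 \<le> D" by (simp add: D_def infdist_nonneg)
  have yw: "y \<in> cball w \<delta>"
    using projector_norm_diff_le[OF y S(2)] x0 norm_ge_zero[of "x 0 - w"]
    unfolding mem_cball dist_norm norm_minus_commute[of w y] by linarith
  define st where "st n = norm (x n - x (n + 1))" for n
  \<comment> \<open>Confinement is derived from the energy bound at the same index, so that it is
    available inside the induction proving \<open>E\<close>. The 4 in \<open>x0\<close> arises
    because \<open>x n\<close> is within \<open>3 * D\<close> of \<open>x 0\<close>, and
    \<open>D\<close> is at most the distance from \<open>x 0\<close> to \<open>w\<close>.\<close>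
  have near: "norm (x n - y) \<le> 2 * D" "norm (x n - x 0) \<le> 3 * D" "x n \<in> cball w \<delta>"
    if E: "(norm (x n - y))\<^sup>2 + \<beta> * (\<Sum>k<n. (st k)\<^sup>2) \<le> (1 + \<epsilon>) ^ n * D\<^sup>2" and "n \<le> l" for n
  proof -
    have "0 \<le> \<beta> * (\<Sum>k<n. (st k)\<^sup>2)" using pos by (auto intro!: mult_nonneg_nonneg sum_nonneg)
    moreover have "(1 + \<epsilon>) ^ n \<le> 4"
      using power_increasing[OF \<open>n \<le> l\<close>, of "1 + \<epsilon>"] pos by linarith
    then have "(1 + \<epsilon>) ^ n * D\<^sup>2 \<le> 4 * D\<^sup>2" by (intro mult_right_mono) auto
    ultimately have "(norm (x n - y))\<^sup>2 \<le> (2 * D)\<^sup>2" using E by (simp add: power_mult_distrib)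
    then show 1: "norm (x n - y) \<le> 2 * D" by (rule power2_le_imp_le) (use D0 in simp)
    show 2: "norm (x n - x 0) \<le> 3 * D"
      using norm_triangle_ineq4[of "x n - y" "x 0 - y"] 1 Dy by simp
    have "norm (x n - w) \<le> norm (x n - x 0) + norm (x 0 - w)"
      using norm_triangle_ineq[of "x n - x 0" "x 0 - w"] by simp
    then show "x n \<in> cball w \<delta>" using 2 Dw x0 by (simp add: dist_norm norm_minus_commute)
  qed
  have E: "(norm (x n - y))\<^sup>2 + \<beta> * (\<Sum>k<n. (st k)\<^sup>2) \<le> (1 + \<epsilon>) ^ n * D\<^sup>2" if "n \<le> l" for n
    using that
  proof (induction n)
    case 0
    then show ?case using Dy by simp
  next
    case (Suc n)
    let ?\<Sigma> = "\<beta> * (\<Sum>k<n. (st k)\<^sup>2)"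
    have IH: "(norm (x n - y))\<^sup>2 + ?\<Sigma> \<le> (1 + \<epsilon>) ^ n * D\<^sup>2" using Suc by simp
    have "0 \<le> ?\<Sigma>" using pos by (auto intro!: mult_nonneg_nonneg sum_nonneg)
    then have "0 \<le> \<epsilon> * ?\<Sigma>" by (rule mult_nonneg_nonneg[OF less_imp_le[OF pos(1)]])
    moreover have "(norm (x (n + 1) - y))\<^sup>2 \<le> (1 + \<epsilon>) * (norm (x n - y))\<^sup>2 - \<beta> * (st n)\<^sup>2"
      unfolding st_def using fejer[of n y] near(3)[OF IH] Suc.prems yS yw by simp
    moreover have "(1 + \<epsilon>) * ((norm (x n - y))\<^sup>2 + ?\<Sigma>) \<le> (1 + \<epsilon>) * ((1 + \<epsilon>) ^ n * D\<^sup>2)"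
      using IH pos by (intro mult_left_mono) auto
    ultimately show ?case by (simp add: algebra_simps)
  qed
  show "norm (x n - x 0) \<le> 3 * infdist (x 0) S" if "n \<le> l"
    using near(2)[OF E that] that by (simp add: D_def)
  have step_sum: "norm (x n - x 0) \<le> (\<Sum>k<n. st k)" for n
  proof (induction n)
    case (Suc n)
    then show ?case
      using norm_triangle_ineq[of "x (n + 1) - x n" "x n - x 0"]
      by (simp add: st_def norm_minus_commute)
  qed simp
  \<comment> \<open>Here \<open>i\<close> is a set that realises regularity at \<open>x 0\<close>,
    and \<open>n\<close> a step of the cycle that treats it.\<close>
  obtain i n where i: "D \<le> \<kappa> * infdist (x 0) (C i)" and n: "n < l" "i \<in> I n"
    using regular cover unfolding D_def by blast
  have "\<nu> * infdist (x n) (C i) \<le> st n"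
    unfolding st_def using coercive[OF n(1) _ n(2)] near(3)[OF E] n by simp
  then have "infdist (x n) (C i) \<le> 1 / \<nu> * st n" using pos by (simp add: field_simps)
  moreover have "infdist (x 0) (C i) \<le> infdist (x n) (C i) + norm (x n - x 0)"
    using infdist_triangle[of "x 0" "C i" "x n"] by (simp add: dist_norm norm_minus_commute)
  moreover have "(\<Sum>k<n. st k) \<le> (\<Sum>k<l. st k)"
    using n by (intro sum_mono2) (auto simp: st_def)
  moreover have "1 / \<nu> * st n \<le> 1 / \<nu> * (\<Sum>k<l. st k)"
    using n pos by (intro mult_left_mono member_le_sum) (auto simp: st_def)
  ultimately have "infdist (x 0) (C i) \<le> (1 + 1 / \<nu>) * (\<Sum>k<l. st k)"
    using step_sum[of n] by (simp only: distrib_right mult_1)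
  then have "\<kappa> * infdist (x 0) (C i) \<le> \<kappa> * ((1 + 1 / \<nu>) * (\<Sum>k<l. st k))"
    using pos(5) by (intro mult_left_mono) auto
  then have "D \<le> \<kappa> * (1 + 1 / \<nu>) * (\<Sum>k<l. st k)"
    unfolding mult.assoc by (rule order_trans[OF i])
  then have "D\<^sup>2 \<le> (\<kappa> * (1 + 1 / \<nu>) * (\<Sum>k<l. st k))\<^sup>2" using D0 by (rule power_mono)
  also have "\<dots> = (\<kappa> * (1 + 1 / \<nu>))\<^sup>2 * (\<Sum>k<l. st k)\<^sup>2" by (rule power_mult_distrib)
  \<comment> \<open>Cauchy-Schwarz for \<open>l\<close> summands.\<close>
  also have "\<dots> \<le> (\<kappa> * (1 + 1 / \<nu>))\<^sup>2 * (l * (\<Sum>k<l. (st k)\<^sup>2))"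
    using sum_squared_le_sum_of_squares[of st "{..<l}"] by (intro mult_left_mono) (auto simp: mult.commute)
  finally have D2: "D\<^sup>2 \<le> l * (\<kappa> * (1 + 1 / \<nu>))\<^sup>2 * (\<Sum>k<l. (st k)\<^sup>2)" by (simp only: mult_ac)
  have "1 + 1 / \<nu> > 0" using pos by (intro add_pos_pos) auto
  then have M: "l * (\<kappa> * (1 + 1 / \<nu>))\<^sup>2 > 0" using n pos by auto
  have cancel: "\<beta> / M * (M * s) = \<beta> * s" if "M > 0" for M s using that by simp
  have "\<beta> / (l * (\<kappa> * (1 + 1 / \<nu>))\<^sup>2) * D\<^sup>2 \<le>
      \<beta> / (l * (\<kappa> * (1 + 1 / \<nu>))\<^sup>2) * (l * (\<kappa> * (1 + 1 / \<nu>))\<^sup>2 * (\<Sum>k<l. (st k)\<^sup>2))"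
    using D2 M pos by (intro mult_left_mono) auto
  also have "\<dots> = \<beta> * (\<Sum>k<l. (st k)\<^sup>2)"
    by (rule cancel[OF M])
  finally have "(norm (x l - y))\<^sup>2 \<le> (1 + \<epsilon>) ^ l * D\<^sup>2 - \<beta> / (l * (\<kappa> * (1 + 1 / \<nu>))\<^sup>2) * D\<^sup>2"
    using E[of l] by linarith
  moreover have "(infdist (x l) S)\<^sup>2 \<le> (norm (x l - y))\<^sup>2"
    using infdist_le[OF yS, of "x l"] by (intro power_mono) (auto simp: dist_norm infdist_nonneg)
  ultimately show "(infdist (x l) S)\<^sup>2 \<le>
      ((1 + \<epsilon>) ^ l - \<beta> / (l * (\<kappa> * (1 + 1 / \<nu>))\<^sup>2)) * (infdist (x 0) S)\<^sup>2"
    by (simp only: D_def left_diff_distrib)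
qed

lemma exists_perturbation_factor:
  assumes "(c::real) > 1"
  obtains \<epsilon> where "\<epsilon> > 0" "(1 + \<epsilon>) ^ l \<le> c"
proof -
  have "((\<lambda>\<epsilon>::real. (1 + \<epsilon>) ^ l) \<longlongrightarrow> (1 + 0) ^ l) (at_right 0)" by (intro tendsto_intros)
  then have "\<forall>\<^sub>F \<epsilon> in at_right 0. (1 + \<epsilon>) ^ l < c" using order_tendstoD(2)[of _ _ _ c] assms by auto
  moreover have "\<forall>\<^sub>F \<epsilon>::real in at_right 0. \<epsilon> > 0" by (simp add: eventually_at_right_less)
  ultimately have "\<forall>\<^sub>F \<epsilon> in at_right 0. \<epsilon> > 0 \<and> (1 + \<epsilon>) ^ l < c" by eventually_elim simp
  then obtain \<epsilon> where "\<epsilon> > 0" "(1 + \<epsilon>) ^ l < c"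
    using eventually_happens[of _ "at_right (0::real)"] by (auto simp: trivial_limit_at_right_real)
  then show thesis using that by force
qed

lemma linearly_regular_aroundE:
  assumes "linearly_regular_around C K w" "finite K" "K \<noteq> {}"
  obtains \<delta> \<kappa> where "\<delta> > 0" "\<kappa> > 0"
    "\<And>x. x \<in> cball w \<delta> \<Longrightarrow> \<exists>i\<in>K. infdist x (\<Inter>i\<in>K. C i) \<le> \<kappa> * infdist x (C i)"
proof -
  obtain \<delta> \<kappa> where *: "\<delta> > 0" "\<kappa> > 0" and le:
    "\<And>x. x \<in> cball w \<delta> \<Longrightarrow> infdist x (\<Inter>i\<in>K. C i) \<le> \<kappa> * Max ((\<lambda>i. infdist x (C i)) ` K)"
    using assms(1) unfolding linearly_regular_around_def by blast
  show thesis
  proof (rule that[OF *])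
    fix x assume "x \<in> cball w \<delta>"
    moreover have "Max ((\<lambda>i. infdist x (C i)) ` K) \<in> (\<lambda>i. infdist x (C i)) ` K"
      using assms by (intro Max_in) auto
    ultimately show "\<exists>i\<in>K. infdist x (\<Inter>i\<in>K. C i) \<le> \<kappa> * infdist x (C i)"
      using le by fastforce
  qed
qed

text \<open>In \<open>fejer\<close> the decrement \<open>\<beta> j\<close> does not depend on
  \<open>\<epsilon>\<close>, so \<open>\<epsilon>\<close> can be fixed once the gain of a cycle is
  known. In \<open>coercive\<close> one number is both constant and radius, so that shrinking it
  preserves the property and a common value exists for all operators.\<close>

lemma cyclic_R_linear_locally_if_quasi_Fejer_coercive:
  fixes T :: "nat \<Rightarrow> 'a::euclidean_space \<Rightarrow> 'a set" and C :: "'i \<Rightarrow> 'a set"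
  defines "S \<equiv> \<lambda>K. \<Inter>i\<in>K. C i"
  assumes l: "l \<ge> 1" and K: "finite K" "K \<noteq> {}" "\<And>i. i \<in> K \<Longrightarrow> closed (C i)" and w: "w \<in> S K"
    and \<beta>: "\<And>j. j \<in> {1..l} \<Longrightarrow> \<beta> j > 0"
    and fejer: "\<And>j \<epsilon>. \<lbrakk>j \<in> {1..l}; \<epsilon> > 0\<rbrakk> \<Longrightarrow>
      \<exists>\<delta>>0. \<forall>x\<in>cball w \<delta>. \<forall>y\<in>S K \<inter> cball w \<delta>. \<forall>z\<in>T j x.
        (norm (z - y))\<^sup>2 \<le> (1 + \<epsilon>) * (norm (x - y))\<^sup>2 - \<beta> j * (norm (x - z))\<^sup>2"
    and coercive: "\<And>j. j \<in> {1..l} \<Longrightarrow>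
      \<exists>\<nu>>0. \<forall>x\<in>cball w \<nu>. \<forall>z\<in>T j x. \<forall>i\<in>I j. \<nu> * infdist x (C i) \<le> norm (x - z)"
    and cover: "K \<subseteq> (\<Union>j\<in>{1..l}. I j)"
    and regular: "linearly_regular_around C K w"
  shows "cyclic_R_linear_locally l T (S K) w"
proof -
  have closed: "closed (S K)" unfolding S_def using K by (intro closed_INT) auto
  obtain d1 \<kappa> where d1: "d1 > 0" and \<kappa>: "\<kappa> > 0" and
    reg: "\<And>x. x \<in> cball w d1 \<Longrightarrow> \<exists>i\<in>K. infdist x (S K) \<le> \<kappa> * infdist x (C i)"
    using linearly_regular_aroundE[OF regular K(1,2)] unfolding S_def by blast
  obtain \<nu> where \<nu>: "\<nu> > 0" and
    coer: "\<And>j. j \<in> {1..l} \<Longrightarrow>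
      \<forall>x\<in>cball w \<nu>. \<forall>z\<in>T j x. \<forall>i\<in>I j. \<nu> * infdist x (C i) \<le> norm (x - z)"
  proof (rule finite_uniform_pos[of "{1..l}" "\<lambda>j \<nu>. \<forall>x\<in>cball w \<nu>. \<forall>z\<in>T j x. \<forall>i\<in>I j.
      \<nu> * infdist x (C i) \<le> norm (x - z)"], goal_cases)
    case (3 j d d')
    show ?case
    proof (intro ballI)
      fix x z i assume "x \<in> cball w d'" "z \<in> T j x" "i \<in> I j"
      then have "d * infdist x (C i) \<le> norm (x - z)" using 3 by auto
      moreover have "d' * infdist x (C i) \<le> d * infdist x (C i)"
        using 3 by (intro mult_right_mono) (auto simp: infdist_nonneg)
      ultimately show "d' * infdist x (C i) \<le> norm (x - z)" by linarith
    qed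
  qed (use coercive that in \<open>auto\<close>)
  obtain b where b: "b > 0" and b_le: "\<And>j. j \<in> {1..l} \<Longrightarrow> b \<le> \<beta> j"
  proof (rule finite_uniform_pos[of "{1..l}" "\<lambda>j b. b \<le> \<beta> j"], goal_cases)
    case (2 j)
    then show ?case using \<beta> by blast
  qed (use that in auto)
  \<comment> \<open>The relative gain over one cycle; the \<open>\<epsilon>\<close> chosen next
    gives back at most half of it.\<close>
  define \<gamma> where "\<gamma> = b / (l * (\<kappa> * (1 + 1 / \<nu>))\<^sup>2)"
  have "1 + 1 / \<nu> > 0" using \<nu> by (intro add_pos_pos) auto
  then have \<gamma>: "\<gamma> > 0" unfolding \<gamma>_def using b \<kappa> l by (intro divide_pos_pos mult_pos_pos zero_less_power) auto
  obtain \<epsilon> where \<epsilon>: "\<epsilon> > 0" and \<epsilon>l: "(1 + \<epsilon>) ^ l \<le> min 4 (1 + \<gamma> / 2)"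
    using exists_perturbation_factor[of "min 4 (1 + \<gamma> / 2)"] \<gamma> by auto
  obtain d2 where d2: "d2 > 0" and
    fej: "\<And>j. j \<in> {1..l} \<Longrightarrow> \<forall>x\<in>cball w d2. \<forall>y\<in>S K \<inter> cball w d2. \<forall>z\<in>T j x.
        (norm (z - y))\<^sup>2 \<le> (1 + \<epsilon>) * (norm (x - y))\<^sup>2 - \<beta> j * (norm (x - z))\<^sup>2"
  proof (rule finite_uniform_pos[of "{1..l}" "\<lambda>j d. \<forall>x\<in>cball w d. \<forall>y\<in>S K \<inter> cball w d. \<forall>z\<in>T j x.
        (norm (z - y))\<^sup>2 \<le> (1 + \<epsilon>) * (norm (x - y))\<^sup>2 - \<beta> j * (norm (x - z))\<^sup>2"], goal_cases)
    case (2 j)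
    then show ?case using fejer \<epsilon> by blast
  next
    case (3 j d d')
    then show ?case by auto
  qed (use that in auto)
  define \<delta> where "\<delta> = min d1 (min d2 \<nu>)"
  have \<delta>: "\<delta> > 0" using d1 d2 \<nu> by (simp add: \<delta>_def)
  \<comment> \<open>The lower bound 1/2 keeps \<open>\<theta>\<close> positive, so that
    \<open>\<rho>\<close> can later be divided by. As \<open>\<theta>\<close> bounds the ratio of
    squared distances over \<open>l\<close> steps, the rate per step is its root of order
    \<open>2 * l\<close>.\<close>
  define \<theta> where "\<theta> = max (1 - \<gamma> / 2) (1 / 2)"
  define q where "q = root (2 * l) \<theta>"
  define \<rho> where "\<rho> = q ^ l"
  have \<theta>: "0 < \<theta>" "\<theta> < 1" using \<gamma> by (auto simp: \<theta>_def)
  then have q: "0 < q" "q < 1" using l by (auto simp: q_def)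
  then have \<rho>: "0 < \<rho>" "\<rho> < 1" using l by (auto simp: \<rho>_def power_less_one_iff)
  have \<rho>2: "\<rho>\<^sup>2 = \<theta>"
  proof -
    have "\<rho>\<^sup>2 = q ^ (2 * l)" by (simp add: \<rho>_def mult.commute flip: power_mult)
    also have "\<dots> = \<theta>" unfolding q_def using \<theta> l by (intro real_root_pow_pos2) auto
    finally show ?thesis .
  qed
  \<comment> \<open>Stated for an arbitrary run of one cycle, to be applied to every shift of the
    sequence by a multiple of \<open>l\<close>.\<close>
  have cycle: "(\<forall>n\<le>l. norm (x n - x 0) \<le> 3 * infdist (x 0) (S K)) \<and>
      infdist (x l) (S K) \<le> \<rho> * infdist (x 0) (S K)"
    if x: "\<And>n. n < l \<Longrightarrow> x (n + 1) \<in> T (n + 1) (x n)" and x0: "4 * norm (x 0 - w) \<le> \<delta>" for x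
  proof -
    have x0': "x 0 \<in> cball w d1"
      using x0 norm_ge_zero[of "x 0 - w"] unfolding mem_cball dist_norm norm_minus_commute[of w "x 0"] \<delta>_def
      by linarith
    have f: "(norm (x (n + 1) - y))\<^sup>2 \<le> (1 + \<epsilon>) * (norm (x n - y))\<^sup>2 - b * (norm (x n - x (n + 1)))\<^sup>2"
      if "n < l" "x n \<in> cball w \<delta>" "y \<in> S K \<inter> cball w \<delta>" for n y
    proof -
      have n: "n + 1 \<in> {1..l}" using that by auto
      have "b * (norm (x n - x (n + 1)))\<^sup>2 \<le> \<beta> (n + 1) * (norm (x n - x (n + 1)))\<^sup>2"
        using b_le[OF n] by (intro mult_right_mono) auto
      moreover have "x n \<in> cball w d2" "y \<in> S K \<inter> cball w d2" using that by (auto simp: \<delta>_def)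
      then have "(norm (x (n + 1) - y))\<^sup>2 \<le>
          (1 + \<epsilon>) * (norm (x n - y))\<^sup>2 - \<beta> (n + 1) * (norm (x n - x (n + 1)))\<^sup>2"
        using fej[OF n] x[OF that(1)] by blast
      ultimately show ?thesis by linarith
    qed
    have c: "\<nu> * infdist (x n) (C i) \<le> norm (x n - x (n + 1))"
      if "n < l" "x n \<in> cball w \<delta>" "i \<in> I (n + 1)" for n i
    proof -
      have n: "n + 1 \<in> {1..l}" using that by auto
      have "x n \<in> cball w \<nu>" using that by (auto simp: \<delta>_def)
      then show ?thesis using coer[OF n] x[OF that(1)] that by blast
    qed
    have cov: "K \<subseteq> (\<Union>n<l. I (n + 1))"
    proof
      fix i assume "i \<in> K"
      then obtain j where "j \<in> {1..l}" "i \<in> I j" using cover by blast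
      then show "i \<in> (\<Union>n<l. I (n + 1))" by (intro UN_I[of "j - 1"]) auto
    qed
    have "(1 + \<epsilon>) ^ l \<le> 4" using \<epsilon>l by simp
    note cyc = quasi_Fejer_cycle[where I = "\<lambda>n. I (n + 1)", OF closed w \<epsilon> this b \<nu> \<kappa> f c cov reg[OF x0'] x0]
    have "(infdist (x l) (S K))\<^sup>2 \<le> ((1 + \<epsilon>) ^ l - \<gamma>) * (infdist (x 0) (S K))\<^sup>2"
      unfolding \<gamma>_def by (rule cyc(2))
    also have "\<dots> \<le> \<theta> * (infdist (x 0) (S K))\<^sup>2"
      using \<epsilon>l by (intro mult_right_mono) (auto simp: \<theta>_def)
    also have "\<dots> = (\<rho> * infdist (x 0) (S K))\<^sup>2" by (simp add: power_mult_distrib \<rho>2)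
    finally have "infdist (x l) (S K) \<le> \<rho> * infdist (x 0) (S K)"
      by (rule power2_le_imp_le) (use \<rho> infdist_nonneg[of "x 0" "S K"] in auto)
    then show ?thesis using cyc(1) by blast
  qed
  \<comment> \<open>This gives \<open>r \<le> \<delta> / 16\<close> and
    \<open>L = 3 * \<delta> / 16\<close> for the \<open>L\<close> below, whence
    \<open>4 * (r + L) \<le> \<delta>\<close>.\<close>
  define r where "r = \<delta> * (1 - \<rho>) / 16"
  have r: "r > 0" using \<delta> \<rho> by (simp add: r_def)
  have "\<exists>xbar\<in>S K. R_linear_convergence x xbar" if cs: "cyclic_sequence l T x" and x0: "x 0 \<in> cball w r" for x
  proof -
    have shift: "x (k * l + n + 1) \<in> T (n + 1) (x (k * l + n))" if "n < l" for k n
      using cs[unfolded cyclic_sequence_def, rule_format, of "k * l + n"] that by simp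
    \<comment> \<open>The sum of the displacement bounds \<open>3 * r * \<rho> ^ k\<close> over all
      cycles.\<close>
    define L where "L = 3 * r / (1 - \<rho>)"
    have "L * (1 - \<rho>) = 3 * r" using \<rho> by (simp add: L_def)
    then have L: "L - L * \<rho> = 3 * r" by (simp add: algebra_simps)
    have L0: "L > 0" using r \<rho> by (simp add: L_def)
    have rL: "4 * (r + L) \<le> \<delta>"
    proof -
      have "r \<le> \<delta> / 16" using \<delta> \<rho> mult_left_mono[of "1 - \<rho>" 1 \<delta>] by (simp add: r_def)
      moreover have "L = 3 * \<delta> / 16"
      proof -
        have "3 * r = 3 * \<delta> / 16 * (1 - \<rho>)" by (simp add: r_def)
        then show ?thesis using \<rho> by (simp add: L_def del: times_divide_eq_left)
      qed
      ultimately have "4 * (r + L) \<le> 4 * (\<delta> / 16 + 3 * \<delta> / 16)" by simp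
      then show ?thesis by simp
    qed
    \<comment> \<open>The term \<open>L * \<rho> ^ k\<close> is the displacement still allowed to
      later cycles; spending it geometrically keeps every cycle start where \<open>cycle\<close>
      applies.\<close>
    have inv: "infdist (x (k * l)) (S K) \<le> r * \<rho> ^ k \<and> norm (x (k * l) - w) \<le> r + L - L * \<rho> ^ k" for k
    proof (induction k)
      case 0
      have "norm (x 0 - w) \<le> r" using x0 by (simp add: dist_norm norm_minus_commute)
      then show ?case using infdist_le[OF w, of "x 0"] by (simp add: dist_norm)
    next
      case (Suc k)
      have "0 \<le> L * \<rho> ^ k" using L0 \<rho> by simp
      then have near: "4 * norm (x (k * l + 0) - w) \<le> \<delta>" using Suc rL by simp
      note cyc = cycle[of "\<lambda>n. x (k * l + n)", OF _ near]
      have c1: "norm (x (k * l + l) - x (k * l)) \<le> 3 * infdist (x (k * l)) (S K)"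
        and c2: "infdist (x (k * l + l)) (S K) \<le> \<rho> * infdist (x (k * l)) (S K)"
        using cyc shift[of _ k] by (auto simp: add.assoc)
      have "\<rho> * infdist (x (k * l)) (S K) \<le> \<rho> * (r * \<rho> ^ k)"
        using Suc \<rho> by (intro mult_left_mono) auto
      then have "infdist (x (Suc k * l)) (S K) \<le> r * \<rho> ^ Suc k"
        using c2 by (simp add: add.commute mult.left_commute)
      moreover have "norm (x (k * l + l) - w) \<le> norm (x (k * l + l) - x (k * l)) + norm (x (k * l) - w)"
        using norm_triangle_ineq[of "x (k * l + l) - x (k * l)" "x (k * l) - w"] by simp
      moreover have "r + L - L * \<rho> ^ k + 3 * (r * \<rho> ^ k) = r + L - L * \<rho> ^ Suc k"
        using arg_cong[OF L, of "\<lambda>t. t * \<rho> ^ k"] by (simp add: algebra_simps)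
      ultimately show ?case using c1 Suc by (simp add: add.commute)
    qed
    \<comment> \<open>Both points are within three distances of the start of their cycle, which
      gives the 6. Dividing by \<open>\<rho>\<close> allows for the position inside the cycle,
      because \<open>n < k * l + l\<close>.\<close>
    have step: "norm (x (n + 1) - x n) \<le> (6 * r / \<rho>) * q ^ n" for n
    proof -
      define k i where "k = n div l" and "i = n mod l"
      have n: "n = k * l + i" and i: "i < l" using l by (auto simp: k_def i_def)
      have "0 \<le> L * \<rho> ^ k" using L0 \<rho> by simp
      then have near: "4 * norm (x (k * l + 0) - w) \<le> \<delta>" using inv[of k] rL by simp
      have "norm (x (k * l + m) - x (k * l)) \<le> 3 * infdist (x (k * l)) (S K)" if "m \<le> l" for m
        using cycle[of "\<lambda>n. x (k * l + n)", OF _ near] shift[of _ k] that by (auto simp: add.assoc)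
      from this[of i] this[of "i + 1"]
      have "norm (x (n + 1) - x n) \<le> 6 * infdist (x (k * l)) (S K)"
        using i norm_triangle_ineq4[of "x (n + 1) - x (k * l)" "x n - x (k * l)"]
        by (simp add: n add.assoc)
      also have "\<dots> \<le> 6 * r / \<rho> * (\<rho> ^ k * \<rho>)" using inv[of k] \<rho> by simp
      also have "\<rho> ^ k * \<rho> = q ^ (k * l + l)"
        by (simp add: \<rho>_def power_add mult.commute flip: power_mult)
      also have "6 * r / \<rho> * q ^ (k * l + l) \<le> 6 * r / \<rho> * q ^ n"
        using i q r \<rho> by (intro mult_left_mono power_decreasing) (auto simp: n)
      finally show ?thesis .
    qed
    obtain z where z: "x \<longlonglongrightarrow> z" "R_linear_convergence x z"
      using geometric_steps_converge[OF step] q by auto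
    \<comment> \<open>The distance to \<open>S K\<close> vanishes along the cycle starts, which
      places the limit in this closed set.\<close>
    have "strict_mono (\<lambda>k. k * l)" using l by (auto intro!: strict_monoI)
    from LIMSEQ_subseq_LIMSEQ[OF z(1) this]
    have "(\<lambda>k. infdist (x (k * l)) (S K)) \<longlonglongrightarrow> infdist z (S K)"
      by (intro tendsto_infdist) (simp add: o_def)
    moreover have "(\<lambda>k. r * \<rho> ^ k) \<longlonglongrightarrow> 0"
      using tendsto_mult_right_zero[OF LIMSEQ_power_zero[of \<rho>], of r] \<rho> by simp
    ultimately have "infdist z (S K) \<le> 0" using inv by (intro LIMSEQ_le) auto
    then have "z \<in> S K"
      using in_closed_iff_infdist_zero[OF closed, of z] w infdist_nonneg[of z "S K"] by auto
    with z(2) show ?thesis by blast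
  qed
  then show ?thesis using r unfolding cyclic_R_linear_locally_def by blast
qed

section \<open>Application to the cyclic algorithm\<close>

theorem corollary5p9:
  fixes m l :: nat
    and C :: "nat \<Rightarrow> 'a::euclidean_space set"
    and lam \<mu> \<alpha> :: "nat \<Rightarrow> real"
    and s t :: "nat \<Rightarrow> nat"
    and w :: 'a
  assumes "m \<ge> 1" and "l \<ge> 1"
    and "\<And>i. i \<in> {1..m} \<Longrightarrow> closed (C i)"
    and "(\<Inter>i\<in>{1..m}. C i) \<noteq> {}"
    and "\<And>j. j \<in> {1..l} \<Longrightarrow> lam j \<in> {0<..2}"
    and "\<And>j. j \<in> {1..l} \<Longrightarrow> \<mu> j \<in> {0<..2}"
    and "\<And>j. j \<in> {1..l} \<Longrightarrow> \<alpha> j \<in> {0<..<1 + beta_hat (lam j) (\<mu> j)}"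
    and "\<And>j. j \<in> {1..l} \<Longrightarrow> s j \<in> {1..m} \<and> t j \<in> {1..m} \<and> s j \<noteq> t j"
    and "s ` {1..l} \<union> t ` {1..l} = {1..m}"
    and "w \<in> (\<Inter>i\<in>{1..m}. C i)"
    and "\<And>i. i \<in> {1..m} \<Longrightarrow> superregular_at (C i) w"
    and "linearly_regular_around C {1..m} w"
    and "\<And>j. j \<in> {1..l} \<Longrightarrow>
           (if min (lam j) (\<mu> j) < 2
            then linearly_regular_around C {s j, t j} w
            else strongly_regular_at (C (s j)) (C (t j)) w)"
  shows "cyclic_R_linear_locally l
           (\<lambda>j. gen_DR_operator (\<alpha> j) (lam j) (\<mu> j) (C (s j)) (C (t j)))
           (\<Inter>i\<in>{1..m}. C i) w"
proof (rule cyclic_R_linear_locally_if_quasi_Fejer_coercive[where I = "\<lambda>j. {s j, t j}"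
      and \<beta> = "\<lambda>j. (1 + beta_hat (lam j) (\<mu> j) - \<alpha> j) / \<alpha> j"])
  fix j assume j: "j \<in> {1..l}"
  let ?A = "C (s j)" and ?B = "C (t j)"
  have lm: "0 < lam j" "lam j \<le> 2" "0 < \<mu> j" "\<mu> j \<le> 2" using assms(5,6)[OF j] by auto
  have \<alpha>: "0 < \<alpha> j" "\<alpha> j < 1 + beta_hat (lam j) (\<mu> j)" using assms(7)[OF j] by auto
  have st: "s j \<in> {1..m}" "t j \<in> {1..m}" using assms(8)[OF j] by auto
  have cl: "closed ?A" "closed ?B" and reg: "superregular_at ?A w" "superregular_at ?B w"
    and w: "w \<in> ?A \<inter> ?B" using assms(3,10,11) st by auto
  show "(1 + beta_hat (lam j) (\<mu> j) - \<alpha> j) / \<alpha> j > 0" using \<alpha> by simp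
  show "\<exists>\<delta>>0. \<forall>x\<in>cball w \<delta>. \<forall>y\<in>(\<Inter>i\<in>{1..m}. C i) \<inter> cball w \<delta>.
      \<forall>z\<in>gen_DR_operator (\<alpha> j) (lam j) (\<mu> j) ?A ?B x.
        (norm (z - y))\<^sup>2 \<le> (1 + \<epsilon>) * (norm (x - y))\<^sup>2
          - (1 + beta_hat (lam j) (\<mu> j) - \<alpha> j) / \<alpha> j * (norm (x - z))\<^sup>2"
    if \<epsilon>: "\<epsilon> > 0" for \<epsilon>
  proof -
    \<comment> \<open>The Fejer inequality holds at points of the pairwise intersection, hence at
      points of the smaller common one.\<close>
    have sub: "(\<Inter>i\<in>{1..m}. C i) \<subseteq> ?A \<inter> ?B" using st by blast
    obtain \<delta> where "\<delta> > 0" and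
      f: "\<And>x y z. \<lbrakk>x \<in> cball w \<delta>; y \<in> ?A \<inter> ?B \<inter> cball w \<delta>;
          z \<in> gen_DR_operator (\<alpha> j) (lam j) (\<mu> j) ?A ?B x\<rbrakk> \<Longrightarrow>
        (norm (z - y))\<^sup>2 \<le> (1 + \<epsilon>) * (norm (x - y))\<^sup>2
          - (1 + beta_hat (lam j) (\<mu> j) - \<alpha> j) / \<alpha> j * (norm (x - z))\<^sup>2"
      using gen_DR_operator_quasi_Fejer[OF reg w lm \<alpha> \<epsilon>] by blast
    show ?thesis
      by (intro exI[of _ \<delta>] conjI ballI f \<open>\<delta> > 0\<close>) (use sub in auto)
  qed
  have "\<exists>\<nu>>0. \<exists>\<delta>>0. \<forall>x\<in>cball w \<delta>. \<forall>z\<in>gen_DR_operator (\<alpha> j) (lam j) (\<mu> j) ?A ?B x.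
      \<nu> * max (infdist x ?A) (infdist x ?B) \<le> norm (x - z)"
  proof (cases "min (lam j) (\<mu> j) < 2")
    case True
    then have "linearly_regular_around C {s j, t j} w" using assms(13)[OF j] by simp
    then obtain d \<kappa> where "d > 0" "\<kappa> > 0"
      "\<And>x. x \<in> cball w d \<Longrightarrow> infdist x (?A \<inter> ?B) \<le> \<kappa> * max (infdist x ?A) (infdist x ?B)"
      unfolding linearly_regular_around_def by auto
    from gen_DR_operator_coercive_if_linearly_regular[OF cl reg w lm True \<alpha>(1) this]
    show ?thesis by metis
  next
    case False
    then have "strongly_regular_at ?A ?B w" using assms(13)[OF j] by simp
    from gen_DR_operator_coercive_if_strongly_regular[OF w this lm \<alpha>(1)]
    show ?thesis by metis
  qed
  then obtain \<nu> \<delta> where "\<nu> > 0" "\<delta> > 0" and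
    c: "\<And>x z. \<lbrakk>x \<in> cball w \<delta>; z \<in> gen_DR_operator (\<alpha> j) (lam j) (\<mu> j) ?A ?B x\<rbrakk> \<Longrightarrow>
      \<nu> * max (infdist x ?A) (infdist x ?B) \<le> norm (x - z)" by blast
  show "\<exists>\<nu>>0. \<forall>x\<in>cball w \<nu>. \<forall>z\<in>gen_DR_operator (\<alpha> j) (lam j) (\<mu> j) ?A ?B x.
      \<forall>i\<in>{s j, t j}. \<nu> * infdist x (C i) \<le> norm (x - z)"
  \<comment> \<open>The minimum fuses constant and radius into the single number that the abstract
    result expects.\<close>
  proof (intro exI[of _ "min \<nu> \<delta>"] conjI ballI)
    show "min \<nu> \<delta> > 0" using \<open>\<nu> > 0\<close> \<open>\<delta> > 0\<close> by simp
    fix x z i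
    assume x: "x \<in> cball w (min \<nu> \<delta>)" and z: "z \<in> gen_DR_operator (\<alpha> j) (lam j) (\<mu> j) ?A ?B x"
      and i: "i \<in> {s j, t j}"
    have "min \<nu> \<delta> * infdist x (C i) \<le> \<nu> * max (infdist x ?A) (infdist x ?B)"
      using i \<open>\<nu> > 0\<close> by (intro mult_mono) (auto simp: infdist_nonneg)
    also have "\<dots> \<le> norm (x - z)" using c x z by auto
    finally show "min \<nu> \<delta> * infdist x (C i) \<le> norm (x - z)" .
  qed
qed (use assms in auto)

end
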